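(* Let $Y$ be a Banach space and let $\omega:(0,\infty)\to(0,\infty)$ be a non-decreasing function such that, for some constant $C_{\mathrm{db}}>1$, $\omega(2t)\le C_{\mathrm{db}}\,\omega(t)$ for all $t\in(0,\infty)$, and $$[\omega]_*:=\sup_{s>0}\frac1{\omega(s)}\int_0^s\omega(t)\,\frac{dt}{t}<\infty .$$ Then there are constants $C_1=C_1(n)$ and $C_2=C_2(n,C_{\mathrm{db}})$ such that $$\|f\|_{\dot C^{0,\omega}(\mathbb R^n,Y)}\le C_1[\omega]_*\|f\|_{\mathrm{BMO}^\omega(\mathbb R^n,Y)},\qquad \|f\|_{\mathrm{BMO}^\omega(\mathbb R^n,Y)}\le C_2\|f\|_{\dot C^{0,\omega}(\mathbb R^n,Y)}$$ for all $f$. Moreover, if in addition $\lim_{t\to\infty}\omega(t)=\infty$, then for each $\Gamma\in\{\mathrm{small},\mathrm{far},\mathrm{large}\}$, $$\dot{\mathrm{VC}}^{0,\omega}_\Gamma(\mathbb R^n,Y)=\mathrm{VMO}^\omega_\Gamma(\mathbb R^n,Y),\qquad \dot{\mathrm{VC}}^{0,\omega}(\mathbb R^n,Y)=\mathrm{VMO}^\omega(\mathbb R^n,Y).$$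
   Context: Here $n\ge1$ and $X=\mathbb R^n$ carries the Euclidean norm. $\dot C^{0,\omega}(X,Y)$ is the set of $f:X\to Y$ with $\|f\|_{\dot C^{0,\omega}(X,Y)}:=\sup_{x\ne y}\frac{\|f(x)-f(y)\|_Y}{\omega(\|x-y\|_X)}<\infty$. For $x\neq y$ put $\mathrm{osc}^\omega_{(x,y)}(f)=\frac{\|f(x)-f(y)\|_Y}{\omega(\|x-y\|_X)}$, and for $\delta>0$ put $\mathrm{osc}^\omega_\delta(f)=\sup\{\mathrm{osc}^\omega_{(x,y)}(f): x,y\in X,\ \|x-y\|_X=\delta\}$. Define $\dot{\mathrm{VC}}^{0,\omega}_{\mathrm{small}}(X,Y)=\{f\in\dot C^{0,\omega}(X,Y):\lim_{\delta\to0}\mathrm{osc}^\omega_\delta(f)=0\}$, $\dot{\mathrm{VC}}^{0,\omega}_{\mathrm{large}}(X,Y)=\{f\in\dot C^{0,\omega}(X,Y):\lim_{\delta\to\infty}\mathrm{osc}^\omega_\delta(f)=0\}$, $\dot{\mathrm{VC}}^{0,\omega}_{\mathrm{far}}(X,Y)=\{f\in\dot C^{0,\omega}(X,Y):\lim_{\delta\to\infty}\sup_{x\ne y,\ \min(\|x\|,\|y\|)>\delta}\mathrm{osc}^\omega_{(x,y)}(f)=0\}$, and $\dot{\mathrm{VC}}^{0,\omega}(X,Y)$ as the intersection of these three sets. Cubes $Q\subset\mathbb R^n$ have sides parallel to the axes and side length $\ell(Q)$; $\langle f\rangle_Q$ and $⨍$-type averages are Bochner averages with respect to Lebesgue measure: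 $\langle f\rangle_Q=\frac1{|Q|}\int_Qf$. For locally Bochner integrable $f\in L^1_{\mathrm{loc}}(\mathbb R^n,Y)$ put $\mathcal O^\omega(f;Q)=\frac1{\omega(\ell(Q))}\frac1{|Q|}\int_Q\|f-\langle f\rangle_Q\|_Y$ and $\|f\|_{\mathrm{BMO}^\omega(\mathbb R^n,Y)}=\sup_Q\mathcal O^\omega(f;Q)$ (supremum over all cubes); $\mathrm{BMO}^\omega(\mathbb R^n,Y)$ is the set of $f\in L^1_{\mathrm{loc}}(\mathbb R^n,Y)$ with $\|f\|_{\mathrm{BMO}^\omega}<\infty$. Define $\mathrm{VMO}^\omega_{\mathrm{small}}=\{f\in\mathrm{BMO}^\omega:\lim_{\delta\to0}\sup_{\ell(Q)=\delta}\mathcal O^\omega(f;Q)=0\}$, $\mathrm{VMO}^\omega_{\mathrm{large}}=\{f\in\mathrm{BMO}^\omega:\lim_{\delta\to\infty}\sup_{\ell(Q)=\delta}\mathcal O^\omega(f;Q)=0\}$, $\mathrm{VMO}^\omega_{\mathrm{far}}=\{f\in\mathrm{BMO}^\omega:\lim_{\delta\to\infty}\sup_{\mathrm{dist}(Q,0)>\delta}\mathcal O^\omega(f;Q)=0\}$, all for functions $\mathbb R^n\to Y$, and $\mathrm{VMO}^\omega(\mathbb R^n,Y)$ as the intersection of the three. Functions in $L^1_{\mathrm{loc}}$ that agree almost everywhere are identified; an element of $L^1_{\mathrm{loc}}$ is regarded as belonging to a class of Hölder functions if it has a (necessarily continuous) representative in that class, and its $\dot C^{0,\omega}$ seminorm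 is that of the representative. *)

theory Defs
  imports "HOL-Analysis.Analysis"
begin

section \<open>Bochner integral with values in an arbitrary Banach space\<close>

text \<open>
  The library predicate \<^const>\<open>has_bochner_integral\<close> restricts the target to class
  \<^class>\<open>second_countable_topology\<close>, that is, to separable spaces. Below is the same definition
  without that restriction. Strong measurability is not lost: it is forced by the approximating
  simple functions. Borel measurability of \<open>f\<close> is nevertheless needed, because
  \<^const>\<open>nn_integral\<close> of a non-measurable function is only a lower integral.
\<close>

definition has_banach_integral ::
    "'a measure \<Rightarrow> ('a \<Rightarrow> 'b::real_normed_vector) \<Rightarrow> 'b \<Rightarrow> bool" where
  "has_banach_integral M f y \<longleftrightarrow>
     f \<in> borel_measurable M \<and>
     (\<exists>s. (\<forall>i. Bochner_Integration.simple_bochner_integrable M (s i)) \<and>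
          (\<lambda>i. \<integral>\<^sup>+x. ennreal (norm (f x - s i x)) \<partial>M) \<longlonglongrightarrow> 0 \<and>
          (\<lambda>i. Bochner_Integration.simple_bochner_integral M (s i)) \<longlonglongrightarrow> y)"

lemma has_banach_integral_iff_has_bochner_integral:
  fixes f :: "'a \<Rightarrow> 'b::{real_normed_vector, second_countable_topology}"
  shows "has_banach_integral M f y \<longleftrightarrow> has_bochner_integral M f y"
  unfolding has_banach_integral_def has_bochner_integral.simps by auto

definition banach_integrable :: "'a measure \<Rightarrow> ('a \<Rightarrow> 'b::real_normed_vector) \<Rightarrow> bool" where
  "banach_integrable M f \<longleftrightarrow> (\<exists>y. has_banach_integral M f y)"

definition banach_integral :: "'a measure \<Rightarrow> ('a \<Rightarrow> 'b::real_normed_vector) \<Rightarrow> 'b" where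
  "banach_integral M f = (THE y. has_banach_integral M f y)"

definition L1_loc :: "(real^'n \<Rightarrow> 'b::real_normed_vector) set" where
  "L1_loc = {f. \<forall>K. compact K \<longrightarrow> banach_integrable (lebesgue_on K) f}"

definition banach_average :: "(real^'n) set \<Rightarrow> (real^'n \<Rightarrow> 'b::real_normed_vector) \<Rightarrow> 'b" where
  "banach_average Q f = (1 / measure lebesgue Q) *\<^sub>R banach_integral (lebesgue_on Q) f"


section \<open>The modulus\<close>

text \<open>A modulus \<open>(0,\<infinity>) \<rightarrow> (0,\<infinity>)\<close> is a total function on the reals whose values at
  non-positive arguments are never used.\<close>

definition dini_const :: "(real \<Rightarrow> real) \<Rightarrow> ennreal" where
  "dini_const \<omega> =
     (SUP s\<in>{0<..}. (\<integral>\<^sup>+t\<in>{0<..<s}. ennreal (\<omega> t / t) \<partial>lborel) / ennreal (\<omega> s))"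


section \<open>Hoelder-type spaces\<close>

definition holder_osc ::
    "(real \<Rightarrow> real) \<Rightarrow> ('a::real_normed_vector \<Rightarrow> 'b::real_normed_vector) \<Rightarrow> 'a \<Rightarrow> 'a \<Rightarrow> ennreal" where
  "holder_osc \<omega> f x y = ennreal (norm (f x - f y) / \<omega> (norm (x - y)))"

definition holder_norm ::
    "(real \<Rightarrow> real) \<Rightarrow> ('a::real_normed_vector \<Rightarrow> 'b::real_normed_vector) \<Rightarrow> ennreal" where
  "holder_norm \<omega> f = (SUP (x, y)\<in>{(x, y). x \<noteq> y}. holder_osc \<omega> f x y)"

definition holder_space ::
    "(real \<Rightarrow> real) \<Rightarrow> ('a::real_normed_vector \<Rightarrow> 'b::real_normed_vector) set" where
  "holder_space \<omega> = {f. holder_norm \<omega> f < \<infinity>}"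

definition VC_small ::
    "(real \<Rightarrow> real) \<Rightarrow> ('a::real_normed_vector \<Rightarrow> 'b::real_normed_vector) set" where
  "VC_small \<omega> = {f \<in> holder_space \<omega>.
     ((\<lambda>\<delta>. SUP (x, y)\<in>{(x, y). norm (x - y) = \<delta>}. holder_osc \<omega> f x y) \<longlongrightarrow> 0) (at_right 0)}"

definition VC_large ::
    "(real \<Rightarrow> real) \<Rightarrow> ('a::real_normed_vector \<Rightarrow> 'b::real_normed_vector) set" where
  "VC_large \<omega> = {f \<in> holder_space \<omega>.
     ((\<lambda>\<delta>. SUP (x, y)\<in>{(x, y). norm (x - y) = \<delta>}. holder_osc \<omega> f x y) \<longlongrightarrow> 0) at_top}"

definition VC_far ::
    "(real \<Rightarrow> real) \<Rightarrow> ('a::real_normed_vector \<Rightarrow> 'b::real_normed_vector) set" where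
  "VC_far \<omega> = {f \<in> holder_space \<omega>.
     ((\<lambda>\<delta>. SUP (x, y)\<in>{(x, y). x \<noteq> y \<and> min (norm x) (norm y) > \<delta>}. holder_osc \<omega> f x y)
        \<longlongrightarrow> 0) at_top}"

definition VC ::
    "(real \<Rightarrow> real) \<Rightarrow> ('a::real_normed_vector \<Rightarrow> 'b::real_normed_vector) set" where
  "VC \<omega> = VC_small \<omega> \<inter> VC_far \<omega> \<inter> VC_large \<omega>"


section \<open>BMO-type spaces\<close>

definition cube :: "real^'n \<Rightarrow> real \<Rightarrow> (real^'n) set" where
  "cube a l = cbox a (a + (\<chi> i. l))"

text \<open>The mean oscillation over the cube with lower corner \<open>a\<close> and side length \<open>l > 0\<close>.\<close>

definition mean_osc ::
    "(real \<Rightarrow> real) \<Rightarrow> (real^'n \<Rightarrow> 'b::real_normed_vector) \<Rightarrow> real^'n \<Rightarrow> real \<Rightarrow> ennreal" where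
  "mean_osc \<omega> f a l =
     (\<integral>\<^sup>+x\<in>cube a l. ennreal (norm (f x - banach_average (cube a l) f)) \<partial>lebesgue)
       / ennreal (\<omega> l * measure lebesgue (cube a l))"

definition bmo_norm ::
    "(real \<Rightarrow> real) \<Rightarrow> (real^'n \<Rightarrow> 'b::real_normed_vector) \<Rightarrow> ennreal" where
  "bmo_norm \<omega> f = (SUP (a, l)\<in>{(a, l). l > 0}. mean_osc \<omega> f a l)"

definition BMO :: "(real \<Rightarrow> real) \<Rightarrow> (real^'n \<Rightarrow> 'b::real_normed_vector) set" where
  "BMO \<omega> = {f \<in> L1_loc. bmo_norm \<omega> f < \<infinity>}"

definition VMO_small :: "(real \<Rightarrow> real) \<Rightarrow> (real^'n \<Rightarrow> 'b::real_normed_vector) set" where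
  "VMO_small \<omega> = {f \<in> BMO \<omega>. ((\<lambda>\<delta>. SUP a. mean_osc \<omega> f a \<delta>) \<longlongrightarrow> 0) (at_right 0)}"

definition VMO_large :: "(real \<Rightarrow> real) \<Rightarrow> (real^'n \<Rightarrow> 'b::real_normed_vector) set" where
  "VMO_large \<omega> = {f \<in> BMO \<omega>. ((\<lambda>\<delta>. SUP a. mean_osc \<omega> f a \<delta>) \<longlongrightarrow> 0) at_top}"

definition VMO_far :: "(real \<Rightarrow> real) \<Rightarrow> (real^'n \<Rightarrow> 'b::real_normed_vector) set" where
  "VMO_far \<omega> = {f \<in> BMO \<omega>.
     ((\<lambda>\<delta>. SUP (a, l)\<in>{(a, l). l > 0 \<and> infdist 0 (cube a l) > \<delta>}. mean_osc \<omega> f a l)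
        \<longlongrightarrow> 0) at_top}"

definition VMO :: "(real \<Rightarrow> real) \<Rightarrow> (real^'n \<Rightarrow> 'b::real_normed_vector) set" where
  "VMO \<omega> = VMO_small \<omega> \<inter> VMO_far \<omega> \<inter> VMO_large \<omega>"


section \<open>Identification of functions that agree almost everywhere\<close>

text \<open>
  No quotient is formed. The sets \<^const>\<open>BMO\<close>, \<^const>\<open>VMO\<close> etc. are unions of classes of
  almost everywhere equal functions; a set \<open>F\<close> of continuous functions is compared with them
  through the functions that have a representative in \<open>F\<close>.
\<close>

definition ae_rep :: "(real^'n \<Rightarrow> 'b) \<Rightarrow> (real^'n \<Rightarrow> 'b) \<Rightarrow> bool" where
  "ae_rep f g \<longleftrightarrow> (AE x in lebesgue. f x = g x)"

definition ae_class :: "(real^'n \<Rightarrow> 'b) set \<Rightarrow> (real^'n \<Rightarrow> 'b) set" where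
  "ae_class F = {f. \<exists>g\<in>F. ae_rep f g}"


section \<open>The constants\<close>

text \<open>
  HOL cannot quantify over the type \<open>'b\<close> of values inside a formula, so a constant introduced by
  an existential quantifier in the theorem would be allowed to depend on the Banach space. Naming
  the constants as closed functions of the dimension, respectively of the dimension and the
  doubling constant, expresses that they depend on nothing else. The values are those given
  by the usual argument (telescoping over halved cubes, and
  \<open>diam Q \<le> 2 ^ n * l\<close> for a cube of side length \<open>l\<close>); they are not claimed to be optimal.
\<close>

definition const_holder_le_bmo :: "nat \<Rightarrow> real" where
  "const_holder_le_bmo n = 2 ^ (n + 3)"

definition const_bmo_le_holder :: "nat \<Rightarrow> real \<Rightarrow> real" where
  "const_bmo_le_holder n Cdb = Cdb ^ n"

end

theory Submission
  imports Defs
begin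

text \<open>
  Passing from a cube to one of its halved subcubes changes the average of \<open>f\<close> by at most
  \<open>2 ^ n * \<omega> l\<close> times the mean oscillation, and the Dini condition sums this over all scales down
  to a point: \<open>\<Sum>\<^sub>k \<omega> (l / 2 ^ k) \<le> (1 + 2 * D) * \<omega> l\<close> with \<open>D = [\<omega>]\<^sub>*\<close>. Applied to \<open>f \<in> BMO\<close>, this
  makes the averages over shrinking cubes converge uniformly to a continuous function \<open>g\<close>. No
  differentiation theorem is needed for \<open>f = g\<close> almost everywhere: subdividing a unit cube into
  cubes of side \<open>2 ^ - k\<close> bounds the integral of \<open>norm (f - g)\<close> by a multiple of \<open>\<omega> (2 * 2 ^ - k)\<close>.

  The constant \<open>2 ^ (n + 1) * (1 + 2 * D)\<close> is at most \<open>2 ^ (n + 3) * D\<close> only if \<open>D \<ge> 1/2\<close>. If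
  \<open>D < 1/2\<close>, then \<open>\<omega> t = o(t)\<close> along dyadic sequences, so that all Hoelder functions are constant.

  For the vanishing spaces the same telescoping is run with small oscillations. Scales or places
  where the oscillation is not small contribute a bounded amount, absorbed because
  \<open>\<omega> t \<longlongrightarrow> \<infinity>\<close>.
\<close>

subsection \<open>The Bochner integral with values in a Banach space\<close>

text \<open>The target need not be separable, so the difference of two Borel measurable functions
  into it may fail to be measurable. Measurability is therefore proved only for real functions such
  as \<open>norm (f x - s x)\<close>, with \<open>s\<close> simple or continuous. Averages are
  estimated through one inequality: the average of \<open>f\<close> is at most as far from a vector
  \<open>c\<close> as the mean of \<open>norm (f x - c)\<close>.

  A factor depending on \<open>n\<close> and \<open>D\<close> alone leaves no room for doubling in
  the bound of the Hoelder norm. So two points are put into a cube whose side is exactly their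
  distance, and every halving is charged to the oscillation over the larger cube. Doubling pays for
  the diameter of a cube in the opposite bound.

  Telescoping only descends in scale. In the passage from VMO to VC this stays within the small
  scales for \<open>VMO_small\<close>. For \<open>VMO_large\<close> it must leave the large scales,
  and for \<open>VMO_far\<close> a common cube of two distant points may contain the origin. There
  \<open>\<omega>\<close> tending to infinity comes in.\<close>

lemma borel_measurable_norm_diff_simple:
  fixes f :: "'a \<Rightarrow> 'b::real_normed_vector"
  assumes f: "f \<in> borel_measurable M" and s: "simple_function M s"
  shows "(\<lambda>x. norm (f x - s x)) \<in> borel_measurable M"
proof -
  have fc: "(\<lambda>x. norm (f x - c)) \<in> borel_measurable M" for c
    by (rule measurable_compose[OF f borel_measurable_continuous_onI]) (intro continuous_intros)
  have S: "s -` {c} \<inter> space M \<in> sets M" for c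
    by (rule simple_functionD(2)[OF s])
  have fin: "finite (s ` space M)"
    using s by (rule simple_functionD(1))
  \<comment> \<open>On the level set \<open>s = c\<close> the function is
    \<open>norm (f x - c)\<close>, a continuous function of \<open>f\<close> alone; finitely many
    such pieces are added.\<close>
  have "(\<lambda>x. \<Sum>c\<in>s ` space M. indicator (s -` {c} \<inter> space M) x * norm (f x - c))
      \<in> borel_measurable M"
    using S fc by (intro borel_measurable_sum borel_measurable_times) auto
  moreover have "(\<Sum>c\<in>s ` space M. indicator (s -` {c} \<inter> space M) x * norm (f x - c)) = norm (f x - s x)"
    if "x \<in> space M" for x
  proof -
    have "(\<Sum>c\<in>s ` space M. indicator (s -` {c} \<inter> space M) x * norm (f x - c))
        = (\<Sum>c\<in>s ` space M. if c = s x then norm (f x - c) else 0)"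
      using that by (intro sum.cong) (auto simp: indicator_def)
    then show ?thesis
      using that fin by simp
  qed
  ultimately show ?thesis
    by (simp cong: measurable_cong)
qed

text \<open>Simple functions \<open>p i\<close> tending to the identity of the domain make
  \<open>g (p i x)\<close> simple and convergent to \<open>g x\<close>, so the claim is a pointwise
  limit of the simple case. No separability of the values enters.\<close>

lemma borel_measurable_norm_diff_continuous:
  fixes f g :: "real^'n \<Rightarrow> 'b::real_normed_vector"
  assumes f: "f \<in> borel_measurable (lebesgue_on K)" and g: "continuous_on UNIV g"
  shows "(\<lambda>x. norm (f x - g x)) \<in> borel_measurable (lebesgue_on K)"
proof -
  have "(\<lambda>x. x) \<in> borel_measurable (lebesgue_on K :: (real^'n) measure)"
    by (intro measurable_restrict_space1 measurable_completion) simp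
  from borel_measurable_implies_sequence_metric[OF this, of 0]
  obtain p :: "nat \<Rightarrow> real^'n \<Rightarrow> real^'n" where p: "\<And>i. simple_function (lebesgue_on K) (p i)"
    "\<And>x. x \<in> space (lebesgue_on K) \<Longrightarrow> (\<lambda>i. p i x) \<longlonglongrightarrow> x" by auto
  show ?thesis
  proof (rule borel_measurable_LIMSEQ_real)
    show "(\<lambda>i. norm (f x - g (p i x))) \<longlonglongrightarrow> norm (f x - g x)" if "x \<in> space (lebesgue_on K)" for x
      using p(2)[OF that] g by (intro tendsto_intros continuous_on_tendsto_compose[OF g]) auto
    show "(\<lambda>x. norm (f x - g (p i x))) \<in> borel_measurable (lebesgue_on K)" for i
      using f simple_function_compose1[OF p(1)[of i], of g]
      by (rule borel_measurable_norm_diff_simple)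
  qed
qed

text \<open>A triangle inequality through \<open>f\<close>. It yields in turn the comparison with a
  constant, the uniqueness of the integral, and the Cauchy property behind its existence.\<close>

lemma norm_simple_bochner_integral_diff_le:
  fixes f :: "'a \<Rightarrow> 'b::real_normed_vector"
  assumes f: "f \<in> borel_measurable M"
    and s: "Bochner_Integration.simple_bochner_integrable M s"
    and t: "Bochner_Integration.simple_bochner_integrable M t"
  shows "ennreal (norm (Bochner_Integration.simple_bochner_integral M s
                      - Bochner_Integration.simple_bochner_integral M t))
      \<le> (\<integral>\<^sup>+x. ennreal (norm (f x - s x)) \<partial>M) + (\<integral>\<^sup>+x. ennreal (norm (f x - t x)) \<partial>M)"
    (is "ennreal (norm (?s - ?t)) \<le> ?S + ?T")
proof -
  have ss: "simple_function M s" "simple_function M t"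
    using s t by (auto elim: Bochner_Integration.simple_bochner_integrable.cases)
  note [measurable] = borel_measurable_norm_diff_simple[OF f ss(1)] borel_measurable_norm_diff_simple[OF f ss(2)]
  have "ennreal (norm (?s - ?t))
      = norm (Bochner_Integration.simple_bochner_integral M (\<lambda>x. s x - t x))"
    using s t by (subst Bochner_Integration.simple_bochner_integral_diff) auto
  also have "\<dots> \<le> Bochner_Integration.simple_bochner_integral M (\<lambda>x. norm (s x - t x))"
    using Bochner_Integration.simple_bochner_integrable_compose2[of "(-)" M "s" "t"] s t
    by (auto intro!: ennreal_leI Bochner_Integration.simple_bochner_integral_norm_bound)
  also have "\<dots> = (\<integral>\<^sup>+x. norm (s x - t x) \<partial>M)"
    using Bochner_Integration.simple_bochner_integrable_compose2[of "\<lambda>x y. norm (x - y)" M "s" "t"] s t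
    by (auto intro!: Bochner_Integration.simple_bochner_integral_eq_nn_integral)
  also have "\<dots> \<le> (\<integral>\<^sup>+x. ennreal (norm (f x - s x)) + ennreal (norm (f x - t x)) \<partial>M)"
  proof (rule nn_integral_mono)
    fix x
    have "norm (s x - t x) \<le> norm (f x - s x) + norm (f x - t x)"
      by (metis dual_order.refl norm_diff_triangle_le norm_minus_commute)
    then show "ennreal (norm (s x - t x)) \<le> ennreal (norm (f x - s x)) + ennreal (norm (f x - t x))"
      by (metis ennreal_leI ennreal_plus norm_ge_zero)
  qed
  also have "\<dots> = ?S + ?T"
    by (rule nn_integral_add) measurable
  finally show ?thesis .
qed

text \<open>The source of every estimate of an average below: after division by the measure, the
  average is within the mean of \<open>norm (f x - c)\<close> of \<open>c\<close>. A constant is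
  simple integrable on a finite measure, so the preceding bound applies to it and passes to the
  limit.\<close>

lemma has_banach_integral_norm_diff_le:
  fixes f :: "'a \<Rightarrow> 'b::real_normed_vector"
  assumes f: "has_banach_integral M f y" and fin: "finite_measure M"
  shows "ennreal (norm (y - measure M (space M) *\<^sub>R c)) \<le> (\<integral>\<^sup>+x. ennreal (norm (f x - c)) \<partial>M)"
proof -
  interpret finite_measure M by fact
  let ?I = "Bochner_Integration.simple_bochner_integral M"
  obtain s where s: "\<And>i. Bochner_Integration.simple_bochner_integrable M (s i)"
    "(\<lambda>i. \<integral>\<^sup>+x. ennreal (norm (f x - s i x)) \<partial>M) \<longlonglongrightarrow> 0" "(\<lambda>i. ?I (s i)) \<longlonglongrightarrow> y"
    and fm: "f \<in> borel_measurable M"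
    using f unfolding has_banach_integral_def by blast
  have c: "Bochner_Integration.simple_bochner_integrable M (\<lambda>x. c)"
    by (intro Bochner_Integration.simple_bochner_integrable.intros) (auto simp: emeasure_eq_measure)
  have Ic: "?I (\<lambda>x. c) = measure M (space M) *\<^sub>R c"
  proof (cases "space M = {}")
    case False
    then have "(\<lambda>x. c) ` space M = {c}" by auto
    then show ?thesis by (simp add: Bochner_Integration.simple_bochner_integral_def)
  qed (simp add: Bochner_Integration.simple_bochner_integral_def)
  have *: "ennreal (norm (?I (s i) - measure M (space M) *\<^sub>R c))
      \<le> (\<integral>\<^sup>+x. ennreal (norm (f x - s i x)) \<partial>M) + (\<integral>\<^sup>+x. ennreal (norm (f x - c)) \<partial>M)" for i
    using norm_simple_bochner_integral_diff_le[OF fm s(1) c, of i] by (simp add: Ic)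
  show ?thesis
  proof (rule tendsto_le[OF sequentially_bot])
    show "(\<lambda>i. (\<integral>\<^sup>+x. ennreal (norm (f x - s i x)) \<partial>M) + (\<integral>\<^sup>+x. ennreal (norm (f x - c)) \<partial>M))
        \<longlonglongrightarrow> (\<integral>\<^sup>+x. ennreal (norm (f x - c)) \<partial>M)"
      using tendsto_add[OF s(2) tendsto_const] by simp
    show "(\<lambda>i. ennreal (norm (?I (s i) - measure M (space M) *\<^sub>R c)))
        \<longlonglongrightarrow> ennreal (norm (y - measure M (space M) *\<^sub>R c))"
      by (intro tendsto_intros s(3))
  qed (use * in auto)
qed

lemma has_banach_integral_unique:
  assumes "has_banach_integral M f y" "has_banach_integral M f z"
  shows "y = z"
proof -
  let ?I = "Bochner_Integration.simple_bochner_integral M"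
  obtain s where s: "\<And>i. Bochner_Integration.simple_bochner_integrable M (s i)"
    "(\<lambda>i. \<integral>\<^sup>+x. ennreal (norm (f x - s i x)) \<partial>M) \<longlonglongrightarrow> 0" "(\<lambda>i. ?I (s i)) \<longlonglongrightarrow> y"
    and fm: "f \<in> borel_measurable M"
    using assms(1) unfolding has_banach_integral_def by blast
  obtain t where t: "\<And>i. Bochner_Integration.simple_bochner_integrable M (t i)"
    "(\<lambda>i. \<integral>\<^sup>+x. ennreal (norm (f x - t i x)) \<partial>M) \<longlonglongrightarrow> 0" "(\<lambda>i. ?I (t i)) \<longlonglongrightarrow> z"
    using assms(2) unfolding has_banach_integral_def by blast
  have "ennreal (norm (y - z)) \<le> 0"
  proof (rule tendsto_le[OF sequentially_bot])
    show "(\<lambda>i. (\<integral>\<^sup>+x. ennreal (norm (f x - s i x)) \<partial>M) + (\<integral>\<^sup>+x. ennreal (norm (f x - t i x)) \<partial>M))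
        \<longlonglongrightarrow> 0"
      using tendsto_add[OF s(2) t(2)] by simp
    show "(\<lambda>i. ennreal (norm (?I (s i) - ?I (t i)))) \<longlonglongrightarrow> ennreal (norm (y - z))"
      by (intro tendsto_intros s(3) t(3))
  qed (use norm_simple_bochner_integral_diff_le[OF fm s(1) t(1)] in auto)
  then show ?thesis
    by (simp add: ennreal_eq_0_iff)
qed

lemma banach_integral_eq:
  assumes "has_banach_integral M f y"
  shows "banach_integral M f = y"
  unfolding banach_integral_def
  using assms has_banach_integral_unique by blast

lemma has_banach_integral_cong_AE:
  assumes f: "has_banach_integral M f y" and g: "g \<in> borel_measurable M" and eq: "AE x in M. f x = g x"
  shows "has_banach_integral M g y"
proof -
  have "(\<integral>\<^sup>+x. ennreal (norm (f x - s x)) \<partial>M) = (\<integral>\<^sup>+x. ennreal (norm (g x - s x)) \<partial>M)" for s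
    using eq by (intro nn_integral_cong_AE) auto
  with f g show ?thesis
    unfolding has_banach_integral_def by simp
qed

text \<open>The point where completeness of the target provides the integral: the integrals of the
  approximations form a Cauchy sequence.\<close>

lemma banach_integrableI_approx:
  fixes f :: "'a \<Rightarrow> 'b::banach"
  assumes f: "f \<in> borel_measurable M"
    and s: "\<And>i. Bochner_Integration.simple_bochner_integrable M (s i)"
      "(\<lambda>i. \<integral>\<^sup>+x. ennreal (norm (f x - s i x)) \<partial>M) \<longlonglongrightarrow> 0"
  shows "banach_integrable M f"
proof -
  let ?I = "\<lambda>i. Bochner_Integration.simple_bochner_integral M (s i)"
  have "Cauchy ?I"
  proof (rule metric_CauchyI)
    fix e :: real assume "e > 0"
    then have "\<forall>\<^sub>F i in sequentially. (\<integral>\<^sup>+x. ennreal (norm (f x - s i x)) \<partial>M) < ennreal (e/2)"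
      using s(2) by (intro order_tendstoD(2)) auto
    then obtain N where N: "\<And>i. i \<ge> N \<Longrightarrow> (\<integral>\<^sup>+x. ennreal (norm (f x - s i x)) \<partial>M) < ennreal (e/2)"
      by (auto simp: eventually_sequentially)
    show "\<exists>N. \<forall>m\<ge>N. \<forall>n\<ge>N. dist (?I m) (?I n) < e"
    proof (intro exI allI impI)
      fix m n assume mn: "m \<ge> N" "n \<ge> N"
      have "ennreal (norm (?I m - ?I n))
          \<le> (\<integral>\<^sup>+x. ennreal (norm (f x - s m x)) \<partial>M) + (\<integral>\<^sup>+x. ennreal (norm (f x - s n x)) \<partial>M)"
        using f s(1) s(1) by (rule norm_simple_bochner_integral_diff_le)
      also have "\<dots> < ennreal (e/2) + ennreal (e/2)"
        using N mn by (intro add_strict_mono) auto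
      also have "\<dots> = ennreal e"
        using \<open>e > 0\<close> by (simp flip: ennreal_plus)
      finally show "dist (?I m) (?I n) < e"
        by (simp add: dist_norm ennreal_less_iff)
    qed
  qed
  then obtain y where "?I \<longlonglongrightarrow> y"
    using Cauchy_convergent convergent_def by blast
  with f s show ?thesis
    unfolding banach_integrable_def has_banach_integral_def by blast
qed

lemma finite_measure_lebesgue_on_compact:
  "compact K \<Longrightarrow> finite_measure (lebesgue_on K)"
  by (rule finite_measure_lebesgue_on) (simp add: lmeasurable_compact)

text \<open>Composing \<open>g\<close> with simple approximations \<open>p i\<close> of the identity
  gives simple functions converging pointwise to \<open>g\<close>; dominated convergence turns this
  into convergence of the integrals.\<close>

lemma continuous_imp_L1_loc:
  fixes g :: "real^'n \<Rightarrow> 'b::banach"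
  assumes g: "continuous_on UNIV g"
  shows "g \<in> L1_loc"
proof -
  have "banach_integrable (lebesgue_on K) g" if K: "compact K" for K
  proof -
    interpret finite_measure "lebesgue_on K"
      using K by (rule finite_measure_lebesgue_on_compact)
    have [simp]: "space (lebesgue_on K) = K" by simp
    obtain R where R: "\<And>x. x \<in> K \<Longrightarrow> norm x \<le> R"
      using K compact_imp_bounded bounded_iff by metis
    have "(\<lambda>x. x) \<in> borel_measurable (lebesgue_on K :: (real^'n) measure)"
      by (intro measurable_restrict_space1 measurable_completion) simp
    from borel_measurable_implies_sequence_metric[OF this, of 0]
    obtain p :: "nat \<Rightarrow> real^'n \<Rightarrow> real^'n" where p: "\<And>i. simple_function (lebesgue_on K) (p i)"
      "\<And>x. x \<in> K \<Longrightarrow> (\<lambda>i. p i x) \<longlonglongrightarrow> x" "\<And>i x. x \<in> K \<Longrightarrow> norm (p i x) \<le> 2 * norm x"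
      by simp blast
    have sg: "simple_function (lebesgue_on K) (\<lambda>x. g (p i x))" for i
      by (rule simple_function_compose1[OF p(1)])
    have gm: "g \<in> borel_measurable (lebesgue_on K)"
      using borel_measurable_continuous_onI[OF g] by (intro measurable_restrict_space1 measurable_completion) simp
    \<comment> \<open>The approximations may leave \<open>K\<close>, but
      \<open>norm (p i x) \<le> 2 * norm x\<close> keeps them in a ball of radius
      \<open>2 * R\<close>, where \<open>g\<close> is bounded.\<close>
    have "bounded (g ` cball 0 (2 * R))"
      using continuous_on_subset[OF g] by (intro compact_imp_bounded compact_continuous_image) auto
    then obtain B where B: "\<And>x. norm x \<le> 2 * R \<Longrightarrow> norm (g x) \<le> B"
      unfolding bounded_iff by (metis image_eqI mem_cball_0)
    have dB: "norm (g x - g (p i x)) \<le> 2 * B" if "x \<in> K" for i x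
    proof -
      have "norm x \<le> 2 * R" "norm (p i x) \<le> 2 * R"
        using R[OF that] p(3)[OF that, of i] norm_ge_zero[of x] by linarith+
      with B[of x] B[of "p i x"] show ?thesis
        using norm_triangle_ineq4[of "g x" "g (p i x)"] by linarith
    qed
    have "(\<lambda>i. \<integral>\<^sup>+x. ennreal (norm (g x - g (p i x))) \<partial>(lebesgue_on K))
        \<longlonglongrightarrow> (\<integral>\<^sup>+x. 0 \<partial>(lebesgue_on K))"
    proof (rule nn_integral_dominated_convergence[where w="\<lambda>_. ennreal (2 * B)"])
      show "(\<lambda>x. ennreal (norm (g x - g (p i x)))) \<in> borel_measurable (lebesgue_on K)" for i
        using borel_measurable_norm_diff_simple[OF gm sg, of i] by measurable
      show "AE x in lebesgue_on K. ennreal (norm (g x - g (p i x))) \<le> ennreal (2 * B)" for i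
        using dB by (intro AE_I2) (auto intro: ennreal_leI)
      show "AE x in lebesgue_on K. (\<lambda>i. ennreal (norm (g x - g (p i x)))) \<longlonglongrightarrow> 0"
      proof (rule AE_I2)
        fix x assume "x \<in> space (lebesgue_on K)"
        then have "(\<lambda>i. g (p i x)) \<longlonglongrightarrow> g x"
          using p(2) by (intro continuous_on_tendsto_compose[OF g]) auto
        then have "(\<lambda>i. ennreal (norm (g x - g (p i x)))) \<longlonglongrightarrow> ennreal (norm (g x - g x))"
          by (intro tendsto_intros)
        then show "(\<lambda>i. ennreal (norm (g x - g (p i x)))) \<longlonglongrightarrow> 0" by simp
      qed
      show "(\<integral>\<^sup>+x. ennreal (2 * B) \<partial>(lebesgue_on K)) < \<infinity>"
        by (simp add: emeasure_eq_measure ennreal_mult_less_top)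
    qed auto
    moreover have "Bochner_Integration.simple_bochner_integrable (lebesgue_on K) (\<lambda>x. g (p i x))" for i
      using sg by (intro Bochner_Integration.simple_bochner_integrable.intros)
        (auto simp: emeasure_eq_measure)
    ultimately show ?thesis
      using gm by (intro banach_integrableI_approx) auto
  qed
  then show ?thesis
    by (simp add: L1_loc_def)
qed

text \<open>Lebesgue measure is complete: preimages under \<open>f\<close> and \<open>g\<close>
  differ by subsets of a null set, which are measurable themselves.\<close>

lemma borel_measurable_lebesgue_AE_cong:
  fixes f g :: "'a::euclidean_space \<Rightarrow> 'b::topological_space"
  assumes g: "g \<in> borel_measurable lebesgue" and eq: "AE x in lebesgue. f x = g x"
  shows "f \<in> borel_measurable lebesgue"
proof (rule measurableI)
  fix A :: "'b set" assume A: "A \<in> sets borel"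
  have gA: "g -` A \<in> sets lebesgue"
    using measurable_sets[OF g A] by simp
  have N: "negligible {x. f x \<noteq> g x}"
    using eq by (simp add: eventually_ae_filter_negligible) (metis (mono_tags, lifting) negligible_subset)
  have "f -` A = (g -` A - {x. f x \<noteq> g x \<and> g x \<in> A}) \<union> {x. f x \<noteq> g x \<and> f x \<in> A}"
    by auto
  moreover have "{x. f x \<noteq> g x \<and> g x \<in> A} \<in> sets lebesgue" "{x. f x \<noteq> g x \<and> f x \<in> A} \<in> sets lebesgue"
    by (intro negligible_imp_sets negligible_subset[OF N]; auto)+
  ultimately show "f -` A \<inter> space lebesgue \<in> sets lebesgue"
    using gA by auto
qed simp

lemma AE_lebesgue_on:
  assumes "AE x in lebesgue. P x" "K \<in> sets lebesgue"
  shows "AE x in lebesgue_on K. P x"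
  using assms by (subst AE_restrict_space_iff) auto

subsection \<open>Averages over cubes\<close>

lemma mem_cube_iff: "x \<in> cube a l \<longleftrightarrow> (\<forall>i. a $ i \<le> x $ i \<and> x $ i \<le> a $ i + l)"
  by (simp add: cube_def mem_box_cart)

lemma cube_mono: "l \<le> l' \<Longrightarrow> cube a l \<subseteq> cube a l'"
  unfolding mem_cube_iff subset_iff by (meson add_left_mono order_trans)

lemma compact_cube [simp]: "compact (cube a l)"
  by (simp add: cube_def)

lemma cube_lmeasurable [simp]: "cube a l \<in> lmeasurable"
  by (simp add: lmeasurable_compact)

lemma cube_sets [simp]: "cube a l \<in> sets lebesgue"
  by (simp add: fmeasurableD)

lemma corner_in_cube: "l \<ge> 0 \<Longrightarrow> a \<in> cube a l"
  by (simp add: mem_cube_iff)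

lemma measure_cube:
  fixes a :: "real^'n"
  assumes "l \<ge> 0"
  shows "measure lebesgue (cube a l) = l ^ CARD('n)"
proof -
  have "cbox a (a + (\<chi> i. l)) \<noteq> {}"
    using corner_in_cube[OF assms, of a] by (auto simp: cube_def)
  then show ?thesis
    by (simp add: cube_def content_cbox_cart)
qed

lemma emeasure_cube:
  fixes a :: "real^'n"
  shows "l \<ge> 0 \<Longrightarrow> emeasure lebesgue (cube a l) = ennreal (l ^ CARD('n))"
  using emeasure_eq_measure2[OF cube_lmeasurable[of a l]] by (simp only: measure_cube)

lemma finite_measure_lebesgue_on_cube: "finite_measure (lebesgue_on (cube a l))"
  by (simp add: finite_measure_lebesgue_on_compact)

lemma measure_lebesgue_on_cube:
  "measure (lebesgue_on (cube a l)) (cube a l) = measure lebesgue (cube a l)"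
  by (simp add: measure_restrict_space)

text \<open>The l1 norm gives the factor \<open>n\<close>, which is weakened to \<open>2 ^ n\<close>
  so that \<open>n\<close> doublings of \<open>\<omega>\<close> absorb it.\<close>

lemma norm_cube_diff_le:
  fixes x y :: "real^'n"
  assumes "x \<in> cube a l" "y \<in> cube a l"
  shows "norm (x - y) \<le> 2 ^ CARD('n) * l"
proof -
  have "\<bar>(x - y) $ i\<bar> \<le> l" for i
    using assms[unfolded mem_cube_iff, rule_format, of i] by auto
  then have "norm (x - y) \<le> (\<Sum>i\<in>(UNIV::'n set). l)"
    by (intro order_trans[OF norm_le_l1_cart] sum_mono) simp
  also have "\<dots> = CARD('n) * l" by simp
  also have "\<dots> \<le> 2 ^ CARD('n) * l"
  proof (intro mult_right_mono)
    show "l \<ge> 0"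
      using assms(1)[unfolded mem_cube_iff, rule_format, of undefined] by linarith
    show "real CARD('n) \<le> 2 ^ CARD('n)"
      by (metis less_imp_le of_nat_less_two_power)
  qed
  finally show ?thesis .
qed

text \<open>The side is the distance itself, so that \<open>\<omega>\<close> can be evaluated at
  \<open>norm (x - y)\<close> without loss. The lower corner is the coordinatewise minimum.\<close>

lemma common_cube:
  fixes x y :: "real^'n"
  obtains a where "x \<in> cube a (norm (x - y))" "y \<in> cube a (norm (x - y))"
proof
  have "\<bar>x $ i - y $ i\<bar> \<le> norm (x - y)" for i
    using component_le_norm_cart[of "x - y" i] by simp
  then show "x \<in> cube (\<chi> i. min (x $ i) (y $ i)) (norm (x - y))"
      "y \<in> cube (\<chi> i. min (x $ i) (y $ i)) (norm (x - y))"
    unfolding mem_cube_iff by (simp_all add: min_def abs_le_iff algebra_simps)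
qed

lemma halve_cube:
  fixes x :: "real^'n"
  assumes "x \<in> cube a l" "l \<ge> 0"
  obtains b where "x \<in> cube b (l/2)" "cube b (l/2) \<subseteq> cube a l"
proof
  let ?b = "\<chi> i. if x $ i \<le> a $ i + l/2 then a $ i else a $ i + l/2"
  show "x \<in> cube ?b (l/2)"
    unfolding mem_cube_iff
  proof
    fix i
    show "?b $ i \<le> x $ i \<and> x $ i \<le> ?b $ i + l/2"
      using assms(1)[unfolded mem_cube_iff, rule_format, of i] assms(2) by (auto split: if_splits)
  qed
  show "cube ?b (l/2) \<subseteq> cube a l"
  proof
    fix z assume z: "z \<in> cube ?b (l/2)"
    show "z \<in> cube a l"
      unfolding mem_cube_iff
    proof
      fix i
      show "a $ i \<le> z $ i \<and> z $ i \<le> a $ i + l"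
        using z[unfolded mem_cube_iff, rule_format, of i] assms(2) by (auto split: if_splits)
    qed
  qed
qed

lemma nn_integral_lebesgue_on_cube:
  "(\<integral>\<^sup>+x. f x \<partial>lebesgue_on (cube a l)) = (\<integral>\<^sup>+x\<in>cube a l. f x \<partial>lebesgue)"
  by (subst nn_integral_restrict_space) auto

lemma L1_loc_has_banach_integral_cube:
  assumes "f \<in> L1_loc"
  shows "has_banach_integral (lebesgue_on (cube a l)) f (banach_integral (lebesgue_on (cube a l)) f)"
proof -
  obtain y where "has_banach_integral (lebesgue_on (cube a l)) f y"
    using assms compact_cube[of a l] unfolding L1_loc_def banach_integrable_def by blast
  then show ?thesis
    by (simp add: banach_integral_eq)
qed

lemma L1_loc_measurable_cube:
  "f \<in> L1_loc \<Longrightarrow> f \<in> borel_measurable (lebesgue_on (cube a l))"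
  using L1_loc_has_banach_integral_cube by (auto simp: has_banach_integral_def)

lemma norm_average_diff_le:
  fixes f :: "real^'n \<Rightarrow> 'b::banach"
  assumes f: "f \<in> L1_loc" and l: "l > 0" and m: "m \<ge> 0"
    and le: "(\<integral>\<^sup>+x\<in>cube a l. ennreal (norm (f x - c)) \<partial>lebesgue) \<le> ennreal (m * l ^ CARD('n))"
  shows "norm (banach_average (cube a l) f - c) \<le> m"
proof -
  let ?I = "banach_integral (lebesgue_on (cube a l)) f" and ?V = "l ^ CARD('n)"
  have V: "?V > 0" using l by simp
  have "ennreal (norm (?I - ?V *\<^sub>R c)) \<le> ennreal (m * ?V)"
    using has_banach_integral_norm_diff_le[OF L1_loc_has_banach_integral_cube[OF f]
        finite_measure_lebesgue_on_cube, of a l c] le l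
    by (simp add: nn_integral_lebesgue_on_cube measure_lebesgue_on_cube measure_cube)
  then have le: "norm (?I - ?V *\<^sub>R c) \<le> m * ?V"
    using m V by (simp add: ennreal_le_iff)
  have "banach_average (cube a l) f - c = (1 / ?V) *\<^sub>R (?I - ?V *\<^sub>R c)"
    using l by (simp add: banach_average_def measure_cube scaleR_diff_right)
  then have "norm (banach_average (cube a l) f - c) = norm (?I - ?V *\<^sub>R c) / ?V"
    using V by simp
  also have "\<dots> \<le> m"
    using le V by (simp add: divide_le_eq)
  finally show ?thesis .
qed

lemma nn_integral_cube_le:
  fixes a :: "real^'n"
  assumes "l \<ge> 0" "m \<ge> 0" "\<And>x. x \<in> cube a l \<Longrightarrow> h x \<le> m"
  shows "(\<integral>\<^sup>+x\<in>cube a l. ennreal (h x) \<partial>lebesgue) \<le> ennreal (m * l ^ CARD('n))"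
proof -
  have "(\<integral>\<^sup>+x\<in>cube a l. ennreal (h x) \<partial>lebesgue) \<le> (\<integral>\<^sup>+x\<in>cube a l. ennreal m \<partial>lebesgue)"
    using assms(3) by (intro nn_integral_mono) (auto simp: indicator_def intro: ennreal_leI)
  also have "\<dots> = ennreal m * emeasure lebesgue (cube a l)"
    by (rule nn_integral_cmult_indicator) simp
  also have "\<dots> = ennreal (m * l ^ CARD('n))"
    using assms by (simp add: emeasure_cube ennreal_mult del: emeasure_completion)
  finally show ?thesis .
qed

lemma norm_average_diff_le_sup:
  fixes f :: "real^'n \<Rightarrow> 'b::banach"
  assumes f: "f \<in> L1_loc" and l: "l > 0" and m: "m \<ge> 0"
    and le: "\<And>x. x \<in> cube a l \<Longrightarrow> norm (f x - c) \<le> m"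
  shows "norm (banach_average (cube a l) f - c) \<le> m"
  using norm_average_diff_le[OF f l m nn_integral_cube_le[OF _ m le]] l by simp

lemma mean_osc_le_iff:
  fixes f :: "real^'n \<Rightarrow> 'b::banach"
  assumes l: "l > 0" and \<omega>: "\<omega> l > 0" and m: "m \<ge> 0"
  shows "mean_osc \<omega> f a l \<le> ennreal m \<longleftrightarrow>
    (\<integral>\<^sup>+x\<in>cube a l. ennreal (norm (f x - banach_average (cube a l) f)) \<partial>lebesgue)
      \<le> ennreal (m * \<omega> l * l ^ CARD('n))"
proof -
  have V: "\<omega> l * measure lebesgue (cube a l) > 0"
    using l \<omega> by (simp add: measure_cube)
  have div: "A / ennreal v \<le> ennreal m \<longleftrightarrow> A \<le> ennreal (m * v)" if "v > 0" for A v
  proof (cases A)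
    case (real r)
    then show ?thesis
      using that m by (simp add: divide_ennreal divide_le_eq)
  next
    case top
    with that show ?thesis
      by (simp add: ennreal_top_divide top_unique)
  qed
  show ?thesis
    unfolding mean_osc_def div[OF V] using l by (simp add: measure_cube mult.assoc)
qed

text \<open>Take the average over the large cube as the constant \<open>c\<close>. Restricting the
  integral of \<open>norm (f x - c)\<close> to the small cube can only decrease it, and dividing by
  the smaller volume costs \<open>q ^ n\<close>. The ratio used later is
  \<open>q = 2\<close>.\<close>

lemma average_subcube_diff_le:
  fixes f :: "real^'n \<Rightarrow> 'b::banach"
  assumes f: "f \<in> L1_loc" and l: "l > 0" "\<omega> l > 0" and m: "m \<ge> 0" and q: "q > 0"
    and osc: "mean_osc \<omega> f a (q * l) \<le> ennreal m" and q\<omega>: "\<omega> (q * l) > 0"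
    and sub: "cube b l \<subseteq> cube a (q * l)"
  shows "norm (banach_average (cube b l) f - banach_average (cube a (q * l)) f)
    \<le> q ^ CARD('n) * m * \<omega> (q * l)"
proof (rule norm_average_diff_le[OF f l(1)])
  let ?h = "\<lambda>x. ennreal (norm (f x - banach_average (cube a (q * l)) f))"
  have "(\<integral>\<^sup>+x\<in>cube b l. ?h x \<partial>lebesgue) \<le> (\<integral>\<^sup>+x\<in>cube a (q * l). ?h x \<partial>lebesgue)"
    using sub by (intro nn_integral_mono) (auto simp: indicator_def)
  also have "\<dots> \<le> ennreal (m * \<omega> (q * l) * (q * l) ^ CARD('n))"
    using osc l q q\<omega> m by (subst (asm) mean_osc_le_iff) auto
  finally show "(\<integral>\<^sup>+x\<in>cube b l. ?h x \<partial>lebesgue)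
      \<le> ennreal (q ^ CARD('n) * m * \<omega> (q * l) * l ^ CARD('n))"
    by (simp add: power_mult_distrib algebra_simps)
  show "0 \<le> q ^ CARD('n) * m * \<omega> (q * l)"
    using q m q\<omega> by simp
qed

lemma banach_average_cong_AE:
  fixes f g :: "real^'n \<Rightarrow> 'b::banach"
  assumes f: "f \<in> L1_loc" and g: "g \<in> L1_loc" and eq: "ae_rep f g"
  shows "banach_average (cube a l) f = banach_average (cube a l) g"
proof -
  have "has_banach_integral (lebesgue_on (cube a l)) g (banach_integral (lebesgue_on (cube a l)) f)"
    using eq by (intro has_banach_integral_cong_AE[OF L1_loc_has_banach_integral_cube[OF f]]
        L1_loc_measurable_cube g AE_lebesgue_on) (auto simp: ae_rep_def)
  then show ?thesis
    by (simp add: banach_average_def banach_integral_eq)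
qed

lemma mean_osc_cong_AE:
  fixes f g :: "real^'n \<Rightarrow> 'b::banach"
  assumes f: "f \<in> L1_loc" and g: "g \<in> L1_loc" and eq: "ae_rep f g"
  shows "mean_osc \<omega> f a l = mean_osc \<omega> g a l"
proof -
  have "(\<integral>\<^sup>+x\<in>cube a l. ennreal (norm (f x - c)) \<partial>lebesgue)
      = (\<integral>\<^sup>+x\<in>cube a l. ennreal (norm (g x - c)) \<partial>lebesgue)" for c
    using eq by (intro nn_integral_cong_AE) (auto simp: ae_rep_def)
  then show ?thesis
    by (simp add: mean_osc_def banach_average_cong_AE[OF assms])
qed

lemma L1_loc_cong_AE:
  fixes f g :: "real^'n \<Rightarrow> 'b::banach"
  assumes g: "continuous_on UNIV g" and eq: "ae_rep f g"
  shows "f \<in> L1_loc"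
proof -
  have "g \<in> borel_measurable lebesgue"
    using borel_measurable_continuous_onI[OF g] by (intro measurable_completion) simp
  then have f: "f \<in> borel_measurable lebesgue"
    using eq unfolding ae_rep_def by (rule borel_measurable_lebesgue_AE_cong)
  have "banach_integrable (lebesgue_on K) f" if K: "compact K" for K
  proof -
    obtain y where y: "has_banach_integral (lebesgue_on K) g y"
      using continuous_imp_L1_loc[OF g] K unfolding L1_loc_def banach_integrable_def by blast
    have "AE x in lebesgue_on K. g x = f x"
    proof (rule AE_lebesgue_on)
      show "AE x in lebesgue. g x = f x"
        using eq unfolding ae_rep_def by eventually_elim simp
      show "K \<in> sets lebesgue"
        using K by (intro fmeasurableD lmeasurable_compact)
    qed
    then have "has_banach_integral (lebesgue_on K) f y"
      using f by (intro has_banach_integral_cong_AE[OF y] measurable_restrict_space1)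
    then show ?thesis
      by (auto simp: banach_integrable_def)
  qed
  then show ?thesis
    by (simp add: L1_loc_def)
qed

lemma le_double: "0 \<le> x \<Longrightarrow> x \<le> 2 * x" for x :: real
  by simp

lemma norm_diff_le_double:
  fixes x y c :: "'a::real_normed_vector"
  assumes "norm (x - c) \<le> M" "norm (y - c) \<le> M"
  shows "norm (x - y) \<le> 2 * M"
  using norm_diff_triangle_le[of x c M y M] assms by (simp add: norm_minus_commute)

section \<open>Dyadic subdivision of unit cubes and null sets\<close>

lemma unit_cube_subset_subdivision:
  fixes a :: "real^'n"
  shows "cube a 1 \<subseteq> (\<Union>z\<in>{z. \<forall>i. z i < (2::nat) ^ k}. cube (\<chi> i. a $ i + real (z i) / 2 ^ k) (1 / 2 ^ k))"
proof
  fix x assume x: "x \<in> cube a 1"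
  define u where "u i = (x $ i - a $ i) * 2 ^ k" for i
  \<comment> \<open>On the upper face \<open>u i = 2 ^ k\<close>, whose floor is one too large as an
    index; the minimum assigns such points to the last closed subcube.\<close>
  define z where "z i = min (2 ^ k - 1) (nat \<lfloor>u i\<rfloor>)" for i
  have u: "0 \<le> u i" "u i \<le> 2 ^ k" for i
    using x[unfolded mem_cube_iff, rule_format, of i] by (auto simp: u_def)
  have z: "real (z i) \<le> u i" "u i \<le> real (z i) + 1" for i
  proof -
    have "real (nat \<lfloor>u i\<rfloor>) \<le> u i" "u i \<le> real (nat \<lfloor>u i\<rfloor>) + 1"
      using u(1)[of i] by linarith+
    moreover have "real (2 ^ k - 1) = 2 ^ k - 1"
      by (simp add: of_nat_diff)
    moreover have "real (z i) = min (real (2 ^ k - 1)) (real (nat \<lfloor>u i\<rfloor>))"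
      unfolding z_def by (rule of_nat_min)
    ultimately show "real (z i) \<le> u i" "u i \<le> real (z i) + 1"
      using u(2)[of i] by linarith+
  qed
  have "z i < 2 ^ k" for i
    by (simp add: z_def min_less_iff_disj)
  moreover have "x \<in> cube (\<chi> i. a $ i + real (z i) / 2 ^ k) (1 / 2 ^ k)"
    unfolding mem_cube_iff using z by (auto simp: u_def field_simps)
  ultimately show "x \<in> (\<Union>z\<in>{z. \<forall>i. z i < 2 ^ k}. cube (\<chi> i. a $ i + real (z i) / 2 ^ k) (1 / 2 ^ k))"
    by blast
qed

text \<open>The \<open>(2 ^ k) ^ n\<close> subcubes exactly cancel the factor
  \<open>(1 / 2 ^ k) ^ n\<close>. Closed subcubes share faces, which is harmless for an upper
  bound.\<close>

lemma nn_integral_unit_cube_le_subdivision: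
  fixes a :: "real^'n" and h :: "real^'n \<Rightarrow> ennreal"
  assumes M: "M \<ge> 0"
    and meas: "\<And>b. h \<in> borel_measurable (lebesgue_on (cube b (1 / 2 ^ k)))"
    and h: "\<And>b. (\<integral>\<^sup>+x\<in>cube b (1 / 2 ^ k). h x \<partial>lebesgue) \<le> ennreal (M * (1 / 2 ^ k) ^ CARD('n))"
  shows "(\<integral>\<^sup>+x\<in>cube a 1. h x \<partial>lebesgue) \<le> ennreal M"
proof -
  let ?Z = "{z. \<forall>i::'n. z i < (2::nat) ^ k}"
  let ?Q = "\<lambda>z. cube (\<chi> i. a $ i + real (z i) / 2 ^ k) (1 / 2 ^ k)"
  have Z: "?Z = (UNIV::'n set) \<rightarrow>\<^sub>E {..<2 ^ k}" by (auto simp: PiE_def)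
  have fin: "finite ?Z" unfolding Z by (intro finite_PiE) auto
  have card: "card ?Z = (2 ^ k) ^ CARD('n)" unfolding Z by (simp add: card_PiE)
  have "(\<integral>\<^sup>+x\<in>cube a 1. h x \<partial>lebesgue) \<le> (\<integral>\<^sup>+x. (\<Sum>z\<in>?Z. h x * indicator (?Q z) x) \<partial>lebesgue)"
  proof (intro nn_integral_mono)
    fix x
    show "h x * indicator (cube a 1) x \<le> (\<Sum>z\<in>?Z. h x * indicator (?Q z) x)"
    proof (cases "x \<in> cube a 1")
      case True
      then obtain z where z: "z \<in> ?Z" "x \<in> ?Q z"
        using unit_cube_subset_subdivision[of a k] by blast
      have "h x * indicator (?Q z) x \<le> (\<Sum>z\<in>?Z. h x * indicator (?Q z) x)"
        by (rule member_le_sum[OF z(1) _ fin]) simp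
      with z(2) True show ?thesis by simp
    qed simp
  qed
  also have "\<dots> = (\<Sum>z\<in>?Z. \<integral>\<^sup>+x\<in>?Q z. h x \<partial>lebesgue)"
  proof (rule nn_integral_sum)
    show "(\<lambda>x. h x * indicator (?Q z) x) \<in> borel_measurable lebesgue" for z
      using meas by (subst borel_measurable_restrict_space_iff_ennreal[symmetric]) auto
  qed
  also have "\<dots> \<le> (\<Sum>z\<in>?Z. ennreal (M * (1 / 2 ^ k) ^ CARD('n)))"
    by (intro sum_mono h)
  also have "\<dots> = ennreal (real (card ?Z) * (M * (1 / 2 ^ k) ^ CARD('n)))"
    by (simp add: ennreal_mult' ennreal_of_nat_eq_real_of_nat)
  also have "real (card ?Z) * (M * (1 / 2 ^ k) ^ CARD('n)) = M"
    unfolding card by (simp add: power_divide)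
  finally show ?thesis .
qed

lemma AE_lebesgue_if_AE_unit_cubes:
  fixes P :: "real^'n \<Rightarrow> bool"
  assumes "\<And>a. AE x in lebesgue. x \<in> cube a 1 \<longrightarrow> P x"
  shows "AE x in lebesgue. P x"
proof -
  have "AE x in lebesgue. \<forall>z :: 'n \<Rightarrow> int. x \<in> cube (\<chi> i. real_of_int (z i)) 1 \<longrightarrow> P x"
    unfolding AE_all_countable using assms by blast
  then show ?thesis
  proof eventually_elim
    fix x :: "real^'n"
    assume *: "\<forall>z :: 'n \<Rightarrow> int. x \<in> cube (\<chi> i. real_of_int (z i)) 1 \<longrightarrow> P x"
    have "x \<in> cube (\<chi> i. real_of_int \<lfloor>x $ i\<rfloor>) 1"
      unfolding mem_cube_iff by (auto intro: floor_correct real_of_int_floor_add_one_ge)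
    with *[rule_format, of "\<lambda>i. \<lfloor>x $ i\<rfloor>"] show "P x" by simp
  qed
qed

subsection \<open>Reformulation of the vanishing conditions with real numbers\<close>

lemma tendsto_0_ennreal_iff:
  fixes F :: "'a \<Rightarrow> ennreal"
  shows "(F \<longlongrightarrow> 0) G \<longleftrightarrow> (\<forall>e>0. \<forall>\<^sub>F x in G. F x \<le> ennreal e)"
proof
  assume F: "(F \<longlongrightarrow> 0) G"
  show "\<forall>e>0. \<forall>\<^sub>F x in G. F x \<le> ennreal e"
  proof (intro allI impI)
    fix e :: real assume "e > 0"
    then have "\<forall>\<^sub>F x in G. F x < ennreal e"
      using F by (intro order_tendstoD(2)) auto
    then show "\<forall>\<^sub>F x in G. F x \<le> ennreal e"
      by eventually_elim simp
  qed
next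
  assume *: "\<forall>e>0. \<forall>\<^sub>F x in G. F x \<le> ennreal e"
  show "(F \<longlongrightarrow> 0) G"
  proof (rule order_tendstoI)
    fix c :: ennreal assume "0 < c"
    \<comment> \<open>The bound \<open>c\<close> may be infinite; a value strictly between
      \<open>0\<close> and \<open>c\<close> is finite and so comes from a real number.\<close>
    then obtain d where "0 < d" "d < c"
      using dense by blast
    then obtain e where e: "d = ennreal e" "e > 0"
      by (cases d) auto
    from * e(2) have "\<forall>\<^sub>F x in G. F x \<le> ennreal e" by blast
    then show "\<forall>\<^sub>F x in G. F x < c"
      by eventually_elim (use \<open>d < c\<close> e in auto)
  qed simp
qed

text \<open>A cube is compact, so its distance from the origin is attained and the strict inequality
  survives the infimum.\<close>

lemma infdist_cube_greater_iff:
  assumes "l > 0"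
  shows "infdist 0 (cube a l) > d \<longleftrightarrow> (\<forall>z\<in>cube a l. norm z > d)"
proof
  assume "infdist 0 (cube a l) > d"
  then show "\<forall>z\<in>cube a l. norm z > d"
    by (metis dist_0_norm infdist_le less_le_trans)
next
  assume *: "\<forall>z\<in>cube a l. norm z > d"
  have "closed (cube a l)" "cube a l \<noteq> {}"
    using corner_in_cube[of l a] assms by (auto intro: compact_imp_closed)
  then obtain z where "z \<in> cube a l" "infdist 0 (cube a l) = dist 0 z"
    by (rule infdist_attains_inf)
  with * show "infdist 0 (cube a l) > d" by simp
qed

lemma VMO_small_iff:
  "f \<in> VMO_small \<omega> \<longleftrightarrow> f \<in> BMO \<omega> \<and>
    (\<forall>e>0. \<exists>d>0. \<forall>a l. 0 < l \<and> l < d \<longrightarrow> mean_osc \<omega> f a l \<le> ennreal e)"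
  (is "_ \<longleftrightarrow> _ \<and> (\<forall>e>0. ?P e)")
proof -
  have "?P e \<longleftrightarrow> (\<forall>\<^sub>F \<delta> in at_right 0. (SUP a. mean_osc \<omega> f a \<delta>) \<le> ennreal e)" for e
    unfolding eventually_at_right_field SUP_le_iff by blast
  then show ?thesis
    by (simp add: VMO_small_def tendsto_0_ennreal_iff)
qed

lemma VMO_large_iff:
  "f \<in> VMO_large \<omega> \<longleftrightarrow> f \<in> BMO \<omega> \<and>
    (\<forall>e>0. \<exists>d>0. \<forall>a l. d < l \<longrightarrow> mean_osc \<omega> f a l \<le> ennreal e)"
  (is "_ \<longleftrightarrow> _ \<and> (\<forall>e>0. ?P e)")
proof -
  have "?P e \<longleftrightarrow> (\<forall>\<^sub>F \<delta> in at_top. (SUP a. mean_osc \<omega> f a \<delta>) \<le> ennreal e)" for e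
  proof
    assume "\<forall>\<^sub>F \<delta> in at_top. (SUP a. mean_osc \<omega> f a \<delta>) \<le> ennreal e"
    then obtain N where "\<forall>\<delta>>N. \<forall>a. mean_osc \<omega> f a \<delta> \<le> ennreal e"
      unfolding eventually_at_top_dense SUP_le_iff by blast
    then show "?P e" by (intro exI[of _ "max N 1"]) auto
  qed (auto simp: eventually_at_top_dense SUP_le_iff)
  then show ?thesis
    by (simp add: VMO_large_def tendsto_0_ennreal_iff)
qed

lemma VMO_far_iff:
  fixes f :: "real^'n \<Rightarrow> 'b::real_normed_vector"
  shows
  "f \<in> VMO_far \<omega> \<longleftrightarrow> f \<in> BMO \<omega> \<and>
    (\<forall>e>0. \<exists>d>0. \<forall>a l. 0 < l \<and> (\<forall>z\<in>cube a l. d < norm z) \<longrightarrow> mean_osc \<omega> f a l \<le> ennreal e)"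
  (is "_ \<longleftrightarrow> _ \<and> (\<forall>e>0. ?P e)")
proof -
  have "?P e \<longleftrightarrow> (\<forall>\<^sub>F \<delta> in at_top.
      (SUP (a, l)\<in>{(a, l). l > 0 \<and> infdist 0 (cube a l) > \<delta>}. mean_osc \<omega> f a l) \<le> ennreal e)"
    (is "_ \<longleftrightarrow> (\<forall>\<^sub>F \<delta> in at_top. ?Q \<delta>)") for e
  proof
    assume "?P e"
    then obtain d where d: "d > 0"
      "\<And>a l. 0 < l \<Longrightarrow> \<forall>z\<in>cube a l. d < norm z \<Longrightarrow> mean_osc \<omega> f a l \<le> ennreal e" by blast
    have "?Q \<delta>" if "\<delta> > d" for \<delta>
    proof (rule SUP_least, clarify)
      fix a :: "real^'n" and l assume l: "l > 0" "\<delta> < infdist 0 (cube a l)"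
      then show "mean_osc \<omega> f a l \<le> ennreal e"
        using that infdist_cube_greater_iff[OF l(1), of d a] by (intro d(2)) auto
    qed
    then show "\<forall>\<^sub>F \<delta> in at_top. ?Q \<delta>"
      unfolding eventually_at_top_dense by blast
  next
    assume "\<forall>\<^sub>F \<delta> in at_top. ?Q \<delta>"
    then obtain N where N: "\<And>\<delta>. \<delta> > N \<Longrightarrow> ?Q \<delta>"
      unfolding eventually_at_top_dense by blast
    define d where "d = max N 0 + 1"
    have d: "d > 0" "d > N" by (auto simp: d_def)
    have "mean_osc \<omega> f a l \<le> ennreal e" if "0 < l" "\<forall>z\<in>cube a l. d < norm z" for a l
    proof -
      have "d < infdist 0 (cube a l)"
        using that(2) unfolding infdist_cube_greater_iff[OF that(1)] .
      with that(1) have "(a, l) \<in> {(a, l). l > 0 \<and> infdist 0 (cube a l) > d}"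
        by simp
      from SUP_upper[OF this, of "\<lambda>(a, l). mean_osc \<omega> f a l"] N[OF d(2)] show ?thesis
        by (simp add: order_trans)
    qed
    with d(1) show "?P e" by blast
  qed
  then show ?thesis
    by (simp add: VMO_far_def tendsto_0_ennreal_iff)
qed

subsection \<open>Dini moduli\<close>

text \<open>The finite Dini constant is carried as a real \<open>D\<close>, which keeps the
  estimates of \<open>\<omega>\<close> and of Hoelder differences among real numbers.\<close>

locale dini_modulus =
  fixes \<omega> :: "real \<Rightarrow> real" and Cdb D :: real
  assumes \<omega>_pos: "t > 0 \<Longrightarrow> \<omega> t > 0"
    and \<omega>_mono_on: "mono_on {0<..} \<omega>"
    and Cdb_gt_1: "Cdb > 1"
    and \<omega>_double: "t > 0 \<Longrightarrow> \<omega> (2 * t) \<le> Cdb * \<omega> t"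
    and dini: "dini_const \<omega> = ennreal D"
    and D_nonneg: "D \<ge> 0"
begin

lemma \<omega>_mono: "0 < s \<Longrightarrow> s \<le> t \<Longrightarrow> \<omega> s \<le> \<omega> t"
  using \<omega>_mono_on by (auto simp: mono_on_def)

lemma \<omega>_double_power: "t > 0 \<Longrightarrow> \<omega> (2 ^ k * t) \<le> Cdb ^ k * \<omega> t"
proof (induction k)
  case (Suc k)
  have "\<omega> (2 ^ Suc k * t) \<le> Cdb * \<omega> (2 ^ k * t)"
    using \<omega>_double[of "2 ^ k * t"] Suc.prems by (simp add: mult.assoc)
  also have "\<dots> \<le> Cdb * (Cdb ^ k * \<omega> t)"
    using Suc Cdb_gt_1 by (intro mult_left_mono) auto
  finally show ?case by simp
qed simp

text \<open>On the interval from \<open>s / 2 ^ Suc k\<close> to \<open>s / 2 ^ k\<close>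
  monotonicity gives \<open>\<omega> t / t \<ge> \<omega> (s / 2 ^ Suc k) / (s / 2 ^ k)\<close>. The
  interval is half as long as its right end point, so its share of the Dini integral is at least
  \<open>\<omega> (s / 2 ^ Suc k) / 2\<close>; this half is the origin of the factor 2. The
  intervals are disjoint, so the shares add up.\<close>

lemma sum_\<omega>_Suc_le:
  assumes s: "s > 0"
  shows "(\<Sum>k<K. \<omega> (s / 2 ^ Suc k)) \<le> 2 * D * \<omega> s"
proof -
  define a where "a k = s / 2 ^ k" for k :: nat
  have a0: "a k > 0" for k using s by (simp add: a_def)
  have aS: "a k = 2 * a (Suc k)" for k by (simp add: a_def)
  have anti: "a k \<le> a j" if "j \<le> k" for j k
    unfolding a_def using s that by (intro divide_left_mono power_increasing) auto
  let ?I = "\<lambda>k. {a (Suc k)<..<a k}"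
  let ?c = "\<lambda>k. \<omega> (a (Suc k)) / a k"
  have c0: "?c k \<ge> 0" for k
    using a0 \<omega>_pos[OF a0] by (simp add: less_imp_le)
  have pw: "(\<Sum>k<K. ennreal (?c k) * indicator (?I k) t) \<le> ennreal (\<omega> t / t) * indicator {0<..<s} t" for t
  proof (cases "\<exists>j<K. t \<in> ?I j")
    case True
    then obtain j where j: "j < K" "t \<in> ?I j" by blast
    have False if "i < k" "t \<in> ?I i" "t \<in> ?I k" for i k
      using that anti[of "Suc i" k] by auto
    with j(2) have uniq: "t \<notin> ?I k" if "k \<noteq> j" for k
      using that by (meson linorder_neqE_nat)
    have ind: "indicator (?I k) t = (if k = j then 1 else (0::ennreal))" for k
      using uniq[of k] j(2) by (cases "k = j") (auto simp del: greaterThanLessThan_iff)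
    have "(\<Sum>k<K. ennreal (?c k) * indicator (?I k) t) = ennreal (?c j)"
      using j(1) by (simp add: ind if_distrib[of "\<lambda>x. _ * x"] cong: if_cong)
    also have "\<dots> \<le> ennreal (\<omega> t / t)"
    proof (intro ennreal_leI frac_le)
      show t: "0 < t" using j a0[of "Suc j"] by auto
      show "\<omega> (a (Suc j)) \<le> \<omega> t"
        using j a0 by (intro \<omega>_mono) auto
      show "0 \<le> \<omega> t" using \<omega>_pos[OF t] by simp
      show "t \<le> a j" using j by auto
    qed
    also have "t \<in> {0<..<s}"
      using j a0[of "Suc j"] anti[of 0 j] by (auto simp: a_def)
    then have "ennreal (\<omega> t / t) = ennreal (\<omega> t / t) * indicator {0<..<s} t" by simp
    finally show ?thesis .
  next
    case False
    then have "(\<Sum>k<K. ennreal (?c k) * indicator (?I k) t) = 0"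
      by (intro sum.neutral) (auto simp: indicator_def)
    then show ?thesis by simp
  qed
  have "ennreal ((\<Sum>k<K. \<omega> (a (Suc k))) / 2) = (\<Sum>k<K. ennreal (\<omega> (a (Suc k)) / 2))"
    using \<omega>_pos[OF a0] by (subst sum_ennreal) (auto simp: sum_divide_distrib intro: less_imp_le)
  also have "\<dots> = (\<Sum>k<K. ennreal (?c k) * emeasure lborel (?I k))"
  proof (intro sum.cong refl)
    fix k
    have "ennreal (?c k) * emeasure lborel (?I k) = ennreal (?c k) * ennreal (a k - a (Suc k))"
      using anti[of k "Suc k"] by simp
    also have "\<dots> = ennreal (?c k * (a k - a (Suc k)))"
      using c0[of k] anti[of k "Suc k"] by (intro ennreal_mult[symmetric]) auto
    also have "?c k * (a k - a (Suc k)) = \<omega> (a (Suc k)) / 2"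
      using a0[of "Suc k"] by (simp add: aS[of k])
    finally show "ennreal (\<omega> (a (Suc k)) / 2) = ennreal (?c k) * emeasure lborel (?I k)" ..
  qed
  also have "\<dots> = (\<Sum>k<K. \<integral>\<^sup>+t. ennreal (?c k) * indicator (?I k) t \<partial>lborel)"
    by (intro sum.cong refl nn_integral_cmult_indicator[symmetric]) simp
  also have "\<dots> = (\<integral>\<^sup>+t. (\<Sum>k<K. ennreal (?c k) * indicator (?I k) t) \<partial>lborel)"
    by (rule nn_integral_sum[symmetric]) simp
  also have "\<dots> \<le> (\<integral>\<^sup>+t\<in>{0<..<s}. ennreal (\<omega> t / t) \<partial>lborel)"
    by (intro nn_integral_mono pw)
  also have "\<dots> \<le> ennreal (D * \<omega> s)"
  proof -
    let ?J = "\<integral>\<^sup>+t\<in>{0<..<s}. ennreal (\<omega> t / t) \<partial>lborel"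
    have "?J / ennreal (\<omega> s) \<le> ennreal D"
      unfolding dini[symmetric] dini_const_def using s by (intro SUP_upper) auto
    then have "?J / ennreal (\<omega> s) * ennreal (\<omega> s) \<le> ennreal D * ennreal (\<omega> s)"
      by (rule mult_right_mono) simp
    moreover have "?J / ennreal (\<omega> s) * ennreal (\<omega> s) = ?J"
      using \<omega>_pos[OF s] by (simp add: ennreal_divide_times ennreal_mult_divide_eq)
    ultimately show ?thesis
      using \<omega>_pos[OF s] D_nonneg by (simp add: ennreal_mult)
  qed
  finally show ?thesis
    using D_nonneg \<omega>_pos[OF s] by (simp add: ennreal_le_iff a_def)
qed

text \<open>The preceding bound covers only the terms after the first. The term
  \<open>\<omega> s\<close> is added by hand, which is where the 1 in \<open>1 + 2 * D\<close> comes
  from.\<close>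

lemma sum_\<omega>_le:
  assumes s: "s > 0"
  shows "(\<Sum>k<K. \<omega> (s / 2 ^ k)) \<le> (1 + 2 * D) * \<omega> s"
proof -
  have "(\<Sum>k<K. \<omega> (s / 2 ^ k)) \<le> (\<Sum>k<Suc K. \<omega> (s / 2 ^ k))"
    using s \<omega>_pos[of "s / 2 ^ K"] by simp
  also have "\<dots> = \<omega> s + (\<Sum>k<K. \<omega> (s / 2 ^ Suc k))"
    by (subst sum.lessThan_Suc_shift) simp
  finally show ?thesis
    using sum_\<omega>_Suc_le[OF s, of K] by (simp add: algebra_simps)
qed

lemma summable_\<omega>: "s > 0 \<Longrightarrow> summable (\<lambda>k. \<omega> (s / 2 ^ k))"
  by (intro summableI_nonneg_bounded[OF _ sum_\<omega>_le] less_imp_le \<omega>_pos) auto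

lemma \<omega>_tendsto_0_seq: "s > 0 \<Longrightarrow> (\<lambda>k. \<omega> (s / 2 ^ k)) \<longlonglongrightarrow> 0"
  by (intro summable_LIMSEQ_zero summable_\<omega>)

lemma \<omega>_small:
  assumes "e > 0"
  obtains d where "d > 0" "\<And>t. 0 < t \<Longrightarrow> t \<le> d \<Longrightarrow> \<omega> t < e"
proof -
  obtain k where "\<omega> (1 / 2 ^ k) < e"
    using order_tendstoD(2)[OF \<omega>_tendsto_0_seq[of 1] assms] by (auto simp: eventually_sequentially)
  then show ?thesis
    using that[of "1 / 2 ^ k"] \<omega>_mono by fastforce
qed

text \<open>For \<open>D < 1/2\<close> the tails \<open>T\<close> of the series \<open>\<omega> (s / 2 ^ k)\<close> contract by a factor below
  \<open>1/2\<close> per step, since each is at most \<open>2 D\<close> times the term preceding it.\<close>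

lemma \<omega>_superlinear:
  assumes s: "s > 0" and D: "D < 1/2"
  shows "(\<lambda>k. 2 ^ k * \<omega> (s / 2 ^ k)) \<longlonglongrightarrow> 0"
proof -
  define a where "a k = \<omega> (s / 2 ^ k)" for k
  define T where "T k = (\<Sum>j. a (j + Suc k))" for k
  \<comment> \<open>Solving \<open>T (Suc k) \<le> 2 * D * (T k - T (Suc k))\<close> for
    \<open>T (Suc k)\<close> gives this ratio. It is below \<open>1/2\<close>, enough to beat
    \<open>2 ^ k\<close>, exactly when \<open>D < 1/2\<close>.\<close>
  define q where "q = 2 * D / (1 + 2 * D)"
  have a0: "a k \<ge> 0" for k
    using s by (simp add: a_def less_imp_le \<omega>_pos)
  have sm: "summable (\<lambda>j. a (j + k))" for k
    using summable_\<omega>[OF s] unfolding summable_iff_shift by (simp add: a_def[abs_def])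
  have T: "T k \<le> 2 * D * a k" for k
    unfolding T_def
  proof (rule suminf_le_const[OF sm])
    show "(\<Sum>j<K. a (j + Suc k)) \<le> 2 * D * a k" for K
      using sum_\<omega>_Suc_le[of "s / 2 ^ k" K] s by (simp add: a_def power_add mult_ac)
  qed
  have TS: "T k = a (Suc k) + T (Suc k)" for k
    unfolding T_def using suminf_split_head[OF sm[of "Suc k"]] by simp
  have q: "0 \<le> q" "2 * q < 1"
    using D D_nonneg by (auto simp: q_def field_simps)
  have step: "T (Suc k) \<le> q * T k" for k
  proof -
    have "T (Suc k) \<le> 2 * D * (T k - T (Suc k))"
      using T[of "Suc k"] TS[of k] by simp
    then show ?thesis
      using D_nonneg by (simp add: q_def field_simps)
  qed
  have Tq: "T k \<le> q ^ k * T 0" for k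
  proof (induction k)
    case (Suc k)
    have "T (Suc k) \<le> q * (q ^ k * T 0)"
      using step[of k] mult_left_mono[OF Suc q(1)] by linarith
    then show ?case by simp
  qed simp
  have aT: "a (Suc k) \<le> T k" for k
    using TS[of k] suminf_nonneg[OF sm[of "Suc (Suc k)"]] a0 by (simp add: T_def)
  have "(\<lambda>k. 2 ^ Suc k * a (Suc k)) \<longlonglongrightarrow> 0"
  proof (rule tendsto_sandwich[OF _ _ tendsto_const])
    have "(\<lambda>k. 2 * T 0 * (2 * q) ^ k) \<longlonglongrightarrow> 2 * T 0 * 0"
      using q by (intro tendsto_mult tendsto_const LIMSEQ_power_zero) auto
    then show "(\<lambda>k. 2 * T 0 * (2 * q) ^ k) \<longlonglongrightarrow> 0" by simp
    have "2 ^ Suc k * a (Suc k) \<le> 2 * T 0 * (2 * q) ^ k" for k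
    proof -
      have "2 ^ Suc k * a (Suc k) \<le> 2 ^ Suc k * (q ^ k * T 0)"
        using aT[of k] Tq[of k] by (intro mult_left_mono) auto
      then show ?thesis by (simp add: power_mult_distrib algebra_simps)
    qed
    then show "\<forall>\<^sub>F k in sequentially. 2 ^ Suc k * a (Suc k) \<le> 2 * T 0 * (2 * q) ^ k" by simp
  qed (use a0 in auto)
  then show ?thesis
    unfolding a_def by (rule LIMSEQ_imp_Suc)
qed

subsection \<open>Hoelder functions\<close>

lemma holder_norm_le_iff:
  assumes "H \<ge> 0"
  shows "holder_norm \<omega> g \<le> ennreal H \<longleftrightarrow> (\<forall>x y. x \<noteq> y \<longrightarrow> norm (g x - g y) \<le> H * \<omega> (norm (x - y)))"
proof -
  have "holder_osc \<omega> g x y \<le> ennreal H \<longleftrightarrow> norm (g x - g y) \<le> H * \<omega> (norm (x - y))" if "x \<noteq> y" for x y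
    using that assms \<omega>_pos[of "norm (x - y)"] by (simp add: holder_osc_def ennreal_le_iff divide_le_eq)
  then show ?thesis
    by (auto simp: holder_norm_def SUP_le_iff)
qed

lemma holder_spaceI:
  assumes "\<And>x y. x \<noteq> y \<Longrightarrow> norm (g x - g y) \<le> H * \<omega> (norm (x - y))" "H \<ge> 0"
  shows "g \<in> holder_space \<omega>"
  using holder_norm_le_iff[of H g] assms
  by (auto simp: holder_space_def intro: le_less_trans[OF _ ennreal_less_top])

text \<open>The last form allows any positive bound \<open>d\<close> on the distance. It includes
  \<open>x = y\<close>, where nothing is known about \<open>\<omega> 0\<close>.\<close>

lemma holder_spaceE:
  assumes "g \<in> holder_space \<omega>"
  obtains H where "H \<ge> 0" "holder_norm \<omega> g = ennreal H"
    "\<And>x y. x \<noteq> y \<Longrightarrow> norm (g x - g y) \<le> H * \<omega> (norm (x - y))"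
    "\<And>x y d. 0 < d \<Longrightarrow> norm (x - y) \<le> d \<Longrightarrow> norm (g x - g y) \<le> H * \<omega> d"
proof -
  obtain H where H: "H \<ge> 0" "holder_norm \<omega> g = ennreal H"
    using assms by (cases "holder_norm \<omega> g") (auto simp: holder_space_def)
  then have *: "\<And>x y. x \<noteq> y \<Longrightarrow> norm (g x - g y) \<le> H * \<omega> (norm (x - y))"
    using holder_norm_le_iff[of H g] by simp
  have "norm (g x - g y) \<le> H * \<omega> d" if "0 < d" "norm (x - y) \<le> d" for x y d
  proof (cases "x = y")
    case True
    then show ?thesis using H(1) \<omega>_pos[OF that(1)] by simp
  next
    case False
    then show ?thesis
      using *[OF False] mult_left_mono[OF \<omega>_mono[OF _ that(2)] H(1)] by simp
  qed
  with H * show ?thesis by (rule that)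
qed

lemma continuous_holder:
  assumes "g \<in> holder_space \<omega>"
  shows "continuous_on UNIV g"
proof -
  obtain H where H: "H \<ge> 0" "\<And>x y d. 0 < d \<Longrightarrow> norm (x - y) \<le> d \<Longrightarrow> norm (g x - g y) \<le> H * \<omega> d"
    using holder_spaceE[OF assms] by metis
  show ?thesis
    unfolding continuous_on_iff
  proof (intro ballI allI impI)
    fix x e assume "(e::real) > 0"
    \<comment> \<open>Dividing by \<open>H + 1\<close> instead of \<open>H\<close> covers
      \<open>H = 0\<close>.\<close>
    then have "e / (H + 1) > 0" using H by simp
    then obtain d where d: "d > 0" "\<omega> d < e / (H + 1)"
      using \<omega>_small by (metis order_refl)
    have "H * \<omega> d < e"
    proof -
      have "H * \<omega> d \<le> (H + 1) * \<omega> d" using \<omega>_pos[OF d(1)] by simp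
      also have "\<dots> < e" using d H by (simp add: field_simps)
      finally show ?thesis .
    qed
    then have "dist (g y) (g x) < e" if "dist y x < d" for y
      using that H(2)[OF d(1), of y x] by (simp add: dist_norm)
    then show "\<exists>d>0. \<forall>x'\<in>UNIV. dist x' x < d \<longrightarrow> dist (g x') (g x) < e"
      using d(1) by blast
  qed
qed

text \<open>Subdividing the segment from \<open>x\<close> to \<open>y\<close> into \<open>2 ^ k\<close> pieces.\<close>

lemma holder_const_if_D_small:
  assumes g: "g \<in> holder_space \<omega>" and D: "D < 1/2"
  shows "g x = g y"
proof (cases "x = y")
  case False
  obtain H where H: "H \<ge> 0" "\<And>x y. x \<noteq> y \<Longrightarrow> norm (g x - g y) \<le> H * \<omega> (norm (x - y))"
    using holder_spaceE[OF g] by metis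
  define p where "p k i = x + (real i / 2 ^ k) *\<^sub>R (y - x)" for k i
  have r: "norm (y - x) > 0" using False by simp
  have le: "norm (g y - g x) \<le> H * (2 ^ k * \<omega> (norm (y - x) / 2 ^ k))" for k
  proof -
    have st: "norm (g (p k (Suc i)) - g (p k i)) \<le> H * \<omega> (norm (y - x) / 2 ^ k)" for i
    proof -
      have e: "p k (Suc i) - p k i = (1 / 2 ^ k) *\<^sub>R (y - x)"
        by (simp add: p_def flip: scaleR_diff_left diff_divide_distrib)
      then have "p k (Suc i) \<noteq> p k i" using False by auto
      from H(2)[OF this] show ?thesis by (simp add: e)
    qed
    have "g y - g x = (\<Sum>i<2 ^ k. g (p k (Suc i)) - g (p k i))"
      by (subst sum_lessThan_telescope) (simp add: p_def)
    also have "norm \<dots> \<le> (\<Sum>i<(2::nat) ^ k. H * \<omega> (norm (y - x) / 2 ^ k))"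
      by (intro sum_norm_le st)
    finally show ?thesis by (simp add: mult_ac)
  qed
  have "(\<lambda>k. H * (2 ^ k * \<omega> (norm (y - x) / 2 ^ k))) \<longlonglongrightarrow> H * 0"
    by (intro tendsto_mult tendsto_const \<omega>_superlinear r D)
  then have "norm (g y - g x) \<le> H * 0"
    by (rule LIMSEQ_le_const) (use le in auto)
  then show ?thesis by simp
qed simp

subsection \<open>Telescoping over halved cubes\<close>

text \<open>At each step the half that still contains \<open>x\<close> is kept. Oscillations are
  requested only for \<open>k < K\<close> and only for subcubes of the starting cube, so that the
  chain can stop at a chosen scale or remain inside a region away from the origin.\<close>

lemma average_chain:
  fixes f :: "real^'n \<Rightarrow> 'b::banach"
  assumes f: "f \<in> L1_loc" and l: "l > 0" and m: "m \<ge> 0" and x: "x \<in> cube a l"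
    and osc: "\<And>b k. k < K \<Longrightarrow> cube b (l / 2 ^ k) \<subseteq> cube a l \<Longrightarrow> mean_osc \<omega> f b (l / 2 ^ k) \<le> ennreal m"
  shows "\<exists>b. x \<in> cube b (l / 2 ^ K) \<and> cube b (l / 2 ^ K) \<subseteq> cube a l \<and>
    norm (banach_average (cube b (l / 2 ^ K)) f - banach_average (cube a l) f)
      \<le> 2 ^ CARD('n) * m * (\<Sum>k<K. \<omega> (l / 2 ^ k))"
  using osc
proof (induction K)
  case 0
  then show ?case using x by (intro exI[of _ a]) simp
next
  case (Suc K)
  obtain b where b: "x \<in> cube b (l / 2 ^ K)" "cube b (l / 2 ^ K) \<subseteq> cube a l"
    "norm (banach_average (cube b (l / 2 ^ K)) f - banach_average (cube a l) f)
      \<le> 2 ^ CARD('n) * m * (\<Sum>k<K. \<omega> (l / 2 ^ k))"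
    using Suc by (metis less_Suc_eq)
  have half: "l / 2 ^ Suc K > 0" and dbl: "2 * (l / 2 ^ Suc K) = l / 2 ^ K"
    using l by auto
  have "l / 2 ^ K / 2 = l / 2 ^ Suc K" by simp
  then obtain c where c: "x \<in> cube c (l / 2 ^ Suc K)" "cube c (l / 2 ^ Suc K) \<subseteq> cube b (l / 2 ^ K)"
    using halve_cube[OF b(1)] l by (metis zero_le_divide_iff zero_le_numeral zero_le_power less_imp_le)
  have "norm (banach_average (cube c (l / 2 ^ Suc K)) f - banach_average (cube b (2 * (l / 2 ^ Suc K))) f)
    \<le> 2 ^ CARD('n) * m * \<omega> (2 * (l / 2 ^ Suc K))"
  proof (rule average_subcube_diff_le[where \<omega>=\<omega>, OF f half \<omega>_pos[OF half] m])
    show "mean_osc \<omega> f b (2 * (l / 2 ^ Suc K)) \<le> ennreal m"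
      unfolding dbl using Suc.prems b(2) by blast
    show "0 < \<omega> (2 * (l / 2 ^ Suc K))"
      using half by (intro \<omega>_pos) linarith
    show "cube c (l / 2 ^ Suc K) \<subseteq> cube b (2 * (l / 2 ^ Suc K))"
      unfolding dbl by (rule c(2))
  qed simp
  then have "norm (banach_average (cube c (l / 2 ^ Suc K)) f - banach_average (cube b (l / 2 ^ K)) f)
    \<le> 2 ^ CARD('n) * m * \<omega> (l / 2 ^ K)"
    unfolding dbl .
  then have "norm (banach_average (cube c (l / 2 ^ Suc K)) f - banach_average (cube a l) f)
      \<le> 2 ^ CARD('n) * m * \<omega> (l / 2 ^ K) + 2 ^ CARD('n) * m * (\<Sum>k<K. \<omega> (l / 2 ^ k))"
    using b(3) by (rule norm_diff_triangle_le)
  then show ?case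
    using c b(2) by (intro exI[of _ c]) (auto simp: algebra_simps)
qed

text \<open>The chain ends at an average over a small cube around \<open>x\<close>, and
  \<open>e\<close> bounds the remaining step to \<open>g x\<close>. It will be either arbitrarily
  small, by continuity, or the Hoelder bound at the scale where the chain stops.\<close>

lemma norm_diff_average_le:
  fixes g :: "real^'n \<Rightarrow> 'b::banach"
  assumes g: "g \<in> L1_loc" and l: "l > 0" and m: "m \<ge> 0" and x: "x \<in> cube a l"
    and osc: "\<And>b k. k < K \<Longrightarrow> cube b (l / 2 ^ k) \<subseteq> cube a l \<Longrightarrow> mean_osc \<omega> g b (l / 2 ^ k) \<le> ennreal m"
    and e: "e \<ge> 0" "\<And>z. norm (z - x) \<le> 2 ^ CARD('n) * (l / 2 ^ K) \<Longrightarrow> norm (g z - g x) \<le> e"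
  shows "norm (banach_average (cube a l) g - g x) \<le> 2 ^ CARD('n) * m * (1 + 2 * D) * \<omega> l + e"
proof -
  obtain b where b: "x \<in> cube b (l / 2 ^ K)"
    "norm (banach_average (cube b (l / 2 ^ K)) g - banach_average (cube a l) g)
      \<le> 2 ^ CARD('n) * m * (\<Sum>k<K. \<omega> (l / 2 ^ k))"
    using average_chain[OF g l m x osc] by metis
  have "norm (banach_average (cube b (l / 2 ^ K)) g - g x) \<le> e"
  proof (rule norm_average_diff_le_sup[OF g _ e(1)])
    show "norm (g z - g x) \<le> e" if "z \<in> cube b (l / 2 ^ K)" for z
      by (intro e(2) norm_cube_diff_le[OF that b(1)])
  qed (use l in simp)
  then have "norm (banach_average (cube a l) g - g x) \<le> 2 ^ CARD('n) * m * (\<Sum>k<K. \<omega> (l / 2 ^ k)) + e"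
    using b(2) by (metis norm_diff_triangle_le norm_minus_commute)
  also have "2 ^ CARD('n) * m * (\<Sum>k<K. \<omega> (l / 2 ^ k)) \<le> 2 ^ CARD('n) * m * ((1 + 2 * D) * \<omega> l)"
    using m by (intro mult_left_mono sum_\<omega>_le l) auto
  finally show ?thesis by (simp add: mult.assoc)
qed

text \<open>Both points are compared with the same average over \<open>cube a l\<close>; this
  doubles the constant to \<open>2 ^ (n + 1)\<close>. Continuity makes the error at the end of the
  chain arbitrarily small.\<close>

lemma norm_diff_le_telescope:
  fixes g :: "real^'n \<Rightarrow> 'b::banach"
  assumes g: "continuous_on UNIV g" and l: "l > 0" and m: "m \<ge> 0" and xy: "x \<in> cube a l" "y \<in> cube a l"
    and osc: "\<And>b k. cube b (l / 2 ^ k) \<subseteq> cube a l \<Longrightarrow> mean_osc \<omega> g b (l / 2 ^ k) \<le> ennreal m"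
  shows "norm (g x - g y) \<le> 2 ^ (CARD('n) + 1) * m * (1 + 2 * D) * \<omega> l" (is "_ \<le> ?R")
proof -
  let ?M = "2 ^ CARD('n) * m * (1 + 2 * D) * \<omega> l"
  have *: "norm (banach_average (cube a l) g - g z) \<le> ?M" if z: "z \<in> cube a l" for z
  proof (rule field_le_epsilon)
    fix e :: real assume e: "e > 0"
    then obtain d where d: "d > 0" "\<And>w. dist w z < d \<Longrightarrow> dist (g w) (g z) < e"
      using g unfolding continuous_on_iff by (metis UNIV_I)
    obtain K where K: "2 ^ CARD('n) * l / d < 2 ^ K"
      using real_arch_pow[of 2] by auto
    then have K: "2 ^ CARD('n) * (l / 2 ^ K) < d"
      using d(1) by (simp add: field_simps)
    show "norm (banach_average (cube a l) g - g z) \<le> ?M + e"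
    proof (rule norm_diff_average_le[OF continuous_imp_L1_loc[OF g] l m z osc])
      show "norm (g w - g z) \<le> e" if "norm (w - z) \<le> 2 ^ CARD('n) * (l / 2 ^ K)" for w
        using d(2)[of w] that K by (simp add: dist_norm)
    qed (use e in auto)
  qed
  from *[OF xy(1)] *[OF xy(2)] have "norm (g x - g y) \<le> 2 * ?M"
    by (intro norm_diff_le_double[of _ "banach_average (cube a l) g"]) (simp_all only: norm_minus_commute)
  also have "2 * ?M = ?R" by (simp add: algebra_simps)
  finally show ?thesis .
qed

text \<open>For oscillations that are small only down to a certain scale: below it the Hoelder bound
  replaces the telescoping and gives the second summand.\<close>

lemma norm_diff_le_telescope_finite:
  fixes g :: "real^'n \<Rightarrow> 'b::banach"
  assumes g: "g \<in> L1_loc" and H: "\<And>x y d. 0 < d \<Longrightarrow> norm (x - y) \<le> d \<Longrightarrow> norm (g x - g y) \<le> H * \<omega> d" "H \<ge> 0"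
    and l: "l > 0" and m: "m \<ge> 0" and xy: "x \<in> cube a l" "y \<in> cube a l"
    and osc: "\<And>b k. k < K \<Longrightarrow> mean_osc \<omega> g b (l / 2 ^ k) \<le> ennreal m"
  shows "norm (g x - g y) \<le> 2 ^ (CARD('n) + 1) * m * (1 + 2 * D) * \<omega> l
    + 2 * H * \<omega> (2 ^ CARD('n) * (l / 2 ^ K))" (is "_ \<le> ?R")
proof -
  let ?M = "2 ^ CARD('n) * m * (1 + 2 * D) * \<omega> l + H * \<omega> (2 ^ CARD('n) * (l / 2 ^ K))"
  have d: "2 ^ CARD('n) * (l / 2 ^ K) > 0" using l by simp
  have *: "norm (banach_average (cube a l) g - g z) \<le> ?M" if z: "z \<in> cube a l" for z
    using g l m z osc
  proof (rule norm_diff_average_le)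
    show "0 \<le> H * \<omega> (2 ^ CARD('n) * (l / 2 ^ K))"
      using H(2) \<omega>_pos[OF d] by simp
  qed (use H(1)[OF d] in auto)
  from *[OF xy(1)] *[OF xy(2)] have "norm (g x - g y) \<le> 2 * ?M"
    by (intro norm_diff_le_double[of _ "banach_average (cube a l) g"]) (simp_all only: norm_minus_commute)
  also have "2 * ?M = ?R" by (simp add: algebra_simps)
  finally show ?thesis .
qed

subsection \<open>The continuous representative\<close>

lemma bmo_normE:
  assumes "f \<in> BMO \<omega>"
  obtains B where "B \<ge> 0" "bmo_norm \<omega> f = ennreal B" "\<And>a l. l > 0 \<Longrightarrow> mean_osc \<omega> f a l \<le> ennreal B"
proof -
  obtain B where B: "B \<ge> 0" "bmo_norm \<omega> f = ennreal B"
    using assms by (cases "bmo_norm \<omega> f") (auto simp: BMO_def)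
  moreover have "mean_osc \<omega> f a l \<le> ennreal B" if "l > 0" for a l
    unfolding B(2)[symmetric] bmo_norm_def using that by (auto intro!: SUP_upper2[of "(a, l)"])
  ultimately show ?thesis by (rule that)
qed

text \<open>The limit is close to the average over every dyadic-sided cube containing
  \<open>x\<close>, not only those used to construct it. Two points of one cube are thereby compared
  through its average, which is what continuity and the integral estimate require.\<close>

lemma BMO_pointwise_limit:
  fixes f :: "real^'n \<Rightarrow> 'b::banach"
  assumes f: "f \<in> BMO \<omega>"
  obtains g :: "real^'n \<Rightarrow> 'b" and F where "F \<ge> 0"
    "\<And>x b k. x \<in> cube b (1 / 2 ^ k) \<Longrightarrow>
      norm (g x - banach_average (cube b (1 / 2 ^ k)) f) \<le> F * \<omega> (2 * (1 / 2 ^ k))"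
proof -
  have fL: "f \<in> L1_loc" using f by (simp add: BMO_def)
  obtain B where B: "B \<ge> 0" "\<And>a l. l > 0 \<Longrightarrow> mean_osc \<omega> f a l \<le> ennreal B"
    using bmo_normE[OF f] by metis
  \<comment> \<open>With the lower corner fixed at \<open>x\<close> the cubes are nested without any
    choice.\<close>
  define A where "A k x = banach_average (cube x (1 / 2 ^ k)) f" for k :: nat and x
  define E where "E = 2 ^ CARD('n) * B * (1 + 2 * D)"
  have E0: "E \<ge> 0" using B D_nonneg by (simp add: E_def)
  have sub: "norm (banach_average (cube b l) f - banach_average (cube a (2 * l)) f)
      \<le> 2 ^ CARD('n) * B * \<omega> (2 * l)" if "l > 0" "cube b l \<subseteq> cube a (2 * l)" for a b l
    using that B by (intro average_subcube_diff_le[OF fL _ \<omega>_pos _ _ _ \<omega>_pos]) auto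
  have step: "norm (A (Suc k) x - A k x) \<le> 2 ^ CARD('n) * B * \<omega> (1 / 2 ^ k)" for k x
  proof -
    have "cube x (1 / 2 ^ Suc k) \<subseteq> cube x (2 * (1 / 2 ^ Suc k))"
      by (intro cube_mono le_double) simp
    from sub[OF _ this] show ?thesis by (simp add: A_def)
  qed
  have "norm (A (k + j) x - A k x) \<le> (\<Sum>i<j. 2 ^ CARD('n) * B * \<omega> (1 / 2 ^ k / 2 ^ i))" for k j x
  proof (induction j)
    case (Suc j)
    have "norm (A (k + Suc j) x - A (k + j) x) \<le> 2 ^ CARD('n) * B * \<omega> (1 / 2 ^ k / 2 ^ j)"
      using step[of "k + j" x] by (simp add: power_add)
    from norm_diff_triangle_le[OF this Suc] show ?case by (simp add: add.commute)
  qed simp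
  moreover have "(\<Sum>i<j. 2 ^ CARD('n) * B * \<omega> (1 / 2 ^ k / 2 ^ i)) \<le> E * \<omega> (1 / 2 ^ k)" for k j :: nat
    unfolding E_def using B sum_\<omega>_le[of "1 / 2 ^ k" j]
    by (simp add: sum_distrib_left[symmetric] mult.assoc mult_left_mono)
  ultimately have AE: "norm (A (k + j) x - A k x) \<le> E * \<omega> (1 / 2 ^ k)" for k j x
    by (rule order_trans)
  have "Cauchy (\<lambda>k. A k x)" for x
  proof (rule metric_CauchyI)
    fix e :: real assume e: "e > 0"
    have "(\<lambda>k. E * \<omega> (1 / 2 ^ k)) \<longlonglongrightarrow> E * 0"
      by (intro tendsto_mult tendsto_const \<omega>_tendsto_0_seq) simp
    then have "\<forall>\<^sub>F k in sequentially. E * \<omega> (1 / 2 ^ k) < e / 2"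
      using e by (intro order_tendstoD(2)[where y="E * 0"]) auto
    then obtain k where k: "E * \<omega> (1 / 2 ^ k) < e / 2"
      by (auto simp: eventually_sequentially)
    have "dist (A i x) (A j x) < e" if "i \<ge> k" "j \<ge> k" for i j
    proof -
      have "norm (A i x - A k x) < e / 2" "norm (A j x - A k x) < e / 2"
        using AE[of k "i - k" x] AE[of k "j - k" x] that k by auto
      then show ?thesis
        by (metis dist_norm dist_commute dist_triangle_half_l)
    qed
    then show "\<exists>M. \<forall>i\<ge>M. \<forall>j\<ge>M. dist (A i x) (A j x) < e" by blast
  qed
  then have "\<exists>y. (\<lambda>k. A k x) \<longlonglongrightarrow> y" for x
    using Cauchy_convergent convergent_def by blast
  then obtain g where g: "\<And>x. (\<lambda>k. A k x) \<longlonglongrightarrow> g x"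
    by metis
  have gA: "norm (g x - A k x) \<le> E * \<omega> (1 / 2 ^ k)" for k x
  proof (rule LIMSEQ_le_const2)
    show "(\<lambda>j. norm (A (k + j) x - A k x)) \<longlonglongrightarrow> norm (g x - A k x)"
      using LIMSEQ_ignore_initial_segment[OF g[of x], of k] by (intro tendsto_intros) (simp add: add.commute)
  qed (use AE in auto)
  show ?thesis
  \<comment> \<open>\<open>E\<close> bounds the tail of the averages at corner \<open>x\<close>. The
    passage from \<open>cube x l\<close> to \<open>cube b l\<close> goes through
    \<open>cube b (2 * l)\<close>, which contains both; its two steps contribute the other summand
    and the argument \<open>2 * l\<close> of \<open>\<omega>\<close>.\<close>
  proof (rule that[of "E + 2 * (2 ^ CARD('n) * B)" g])
    show "E + 2 * (2 ^ CARD('n) * B) \<ge> 0" using E0 B by simp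
    fix x b :: "real^'n" and k :: nat
    assume x: "x \<in> cube b (1 / 2 ^ k)"
    let ?l = "(1::real) / 2 ^ k"
    have l: "?l > 0" by simp
    have mid: "cube x ?l \<subseteq> cube b (2 * ?l)" "cube b ?l \<subseteq> cube b (2 * ?l)"
    proof -
      show "cube b ?l \<subseteq> cube b (2 * ?l)"
        by (intro cube_mono le_double) simp
      show "cube x ?l \<subseteq> cube b (2 * ?l)"
      proof
        fix z assume z: "z \<in> cube x ?l"
        show "z \<in> cube b (2 * ?l)"
          unfolding mem_cube_iff
        proof
          fix i show "b $ i \<le> z $ i \<and> z $ i \<le> b $ i + 2 * ?l"
            using z[unfolded mem_cube_iff, rule_format, of i] x[unfolded mem_cube_iff, rule_format, of i] l
            by linarith
        qed
      qed
    qed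
    let ?c = "banach_average (cube b (2 * ?l)) f" and ?w = "2 ^ CARD('n) * B * \<omega> (2 * ?l)"
    have "norm (g x - A k x) \<le> E * \<omega> (2 * ?l)"
      using gA[of x k] mult_left_mono[OF \<omega>_mono[OF l le_double[OF less_imp_le[OF l]]] E0]
      by (rule order_trans)
    moreover have "norm (A k x - ?c) \<le> ?w"
      unfolding A_def by (rule sub[OF l mid(1)])
    moreover have "norm (?c - banach_average (cube b ?l) f) \<le> ?w"
      using sub[OF l mid(2)] by (simp only: norm_minus_commute)
    ultimately have "norm (g x - banach_average (cube b ?l) f) \<le> E * \<omega> (2 * ?l) + ?w + ?w"
      by (intro norm_diff_triangle_le)
    then show "norm (g x - banach_average (cube b ?l) f)
        \<le> (E + 2 * (2 ^ CARD('n) * B)) * \<omega> (2 * ?l)"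
      by (simp add: algebra_simps)
  qed
qed

lemma BMO_has_continuous_rep:
  fixes f :: "real^'n \<Rightarrow> 'b::banach"
  assumes f: "f \<in> BMO \<omega>"
  obtains g where "continuous_on UNIV g" "ae_rep f g"
proof -
  have fL: "f \<in> L1_loc" using f by (simp add: BMO_def)
  obtain B where B: "B \<ge> 0" "\<And>a l. l > 0 \<Longrightarrow> mean_osc \<omega> f a l \<le> ennreal B"
    using bmo_normE[OF f] by metis
  obtain g :: "real^'n \<Rightarrow> 'b" and F where F: "F \<ge> 0"
    "\<And>x b k. x \<in> cube b (1 / 2 ^ k) \<Longrightarrow>
      norm (g x - banach_average (cube b (1 / 2 ^ k)) f) \<le> F * \<omega> (2 * (1 / 2 ^ k))"
    using BMO_pointwise_limit[OF f] by metis
  have lim: "(\<lambda>k. C * \<omega> (2 * (1 / 2 ^ k))) \<longlonglongrightarrow> 0" for C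
    using tendsto_mult[OF tendsto_const[of C] \<omega>_tendsto_0_seq[of 2]] by simp
  have gc: "continuous_on UNIV g"
    unfolding continuous_on_iff
  proof (intro ballI allI impI)
    fix x e assume e: "(e::real) > 0"
    then obtain k where k: "2 * F * \<omega> (2 * (1 / 2 ^ k)) < e"
      using order_tendstoD(2)[OF lim] by (fastforce simp: eventually_sequentially)
    \<comment> \<open>Points closer than \<open>1 / 2 ^ k\<close> lie in a common cube of that side,
      and both values of \<open>g\<close> are near its average.\<close>
    have "dist (g y) (g x) < e" if "dist y x < 1 / 2 ^ k" for y
    proof -
      obtain a where a: "y \<in> cube a (norm (y - x))" "x \<in> cube a (norm (y - x))"
        by (rule common_cube)
      have "cube a (norm (y - x)) \<subseteq> cube a (1 / 2 ^ k)"
        using that by (intro cube_mono) (simp add: dist_norm)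
      then have "norm (g y - banach_average (cube a (1 / 2 ^ k)) f) \<le> F * \<omega> (2 * (1 / 2 ^ k))"
          "norm (g x - banach_average (cube a (1 / 2 ^ k)) f) \<le> F * \<omega> (2 * (1 / 2 ^ k))"
        using a by (blast intro: F(2))+
      then have "norm (g y - g x) \<le> 2 * (F * \<omega> (2 * (1 / 2 ^ k)))"
        by (rule norm_diff_le_double)
      with k show ?thesis by (simp add: dist_norm)
    qed
    then show "\<exists>d>0. \<forall>x'\<in>UNIV. dist x' x < d \<longrightarrow> dist (g x') (g x) < e"
      by (intro exI[of _ "1 / 2 ^ k"]) auto
  qed
  have meas: "(\<lambda>x. ennreal (norm (f x - g x))) \<in> borel_measurable (lebesgue_on (cube a l))" for a l
    using borel_measurable_norm_diff_continuous[OF L1_loc_measurable_cube[OF fL] gc] by measurable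
  \<comment> \<open>On each small cube the average of \<open>f\<close> is an intermediate value:
    \<open>B\<close> controls \<open>f\<close> against it in the mean, \<open>F\<close> controls
    \<open>g\<close> against it pointwise.\<close>
  have le: "(\<integral>\<^sup>+x\<in>cube b (1 / 2 ^ k). ennreal (norm (f x - g x)) \<partial>lebesgue)
      \<le> ennreal ((B + F) * \<omega> (2 * (1 / 2 ^ k)) * (1 / 2 ^ k) ^ CARD('n))" for b k
  proof -
    let ?l = "(1::real) / 2 ^ k"
    let ?Q = "cube b ?l" and ?V = "?l ^ CARD('n)" and ?w = "\<omega> (2 * ?l)"
    let ?c = "banach_average ?Q f"
    have w: "0 \<le> ?w" using \<omega>_pos[of "2 * ?l"] by simp
    have fc: "(\<lambda>x. ennreal (norm (f x - ?c)) * indicator ?Q x) \<in> borel_measurable lebesgue"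
      using borel_measurable_norm_diff_continuous[OF L1_loc_measurable_cube[OF fL, of b ?l] continuous_on_const[of UNIV ?c]]
      by (subst borel_measurable_restrict_space_iff_ennreal[symmetric]) auto
    have osc: "(\<integral>\<^sup>+x\<in>?Q. ennreal (norm (f x - ?c)) \<partial>lebesgue) \<le> ennreal (B * ?w * ?V)"
    proof -
      have "(\<integral>\<^sup>+x\<in>?Q. ennreal (norm (f x - ?c)) \<partial>lebesgue) \<le> ennreal (B * \<omega> ?l * ?V)"
        using B(2)[of ?l b] mean_osc_le_iff[of ?l \<omega> B f b] \<omega>_pos[of ?l] B(1) by simp
      also have "\<dots> \<le> ennreal (B * ?w * ?V)"
        using B(1) by (intro ennreal_leI mult_right_mono mult_left_mono \<omega>_mono le_double) auto
      finally show ?thesis .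
    qed
    have "(\<integral>\<^sup>+x\<in>?Q. ennreal (norm (f x - g x)) \<partial>lebesgue)
        \<le> (\<integral>\<^sup>+x. ennreal (norm (f x - ?c)) * indicator ?Q x + ennreal (F * ?w) * indicator ?Q x \<partial>lebesgue)"
    proof (intro nn_integral_mono)
      fix x
      show "ennreal (norm (f x - g x)) * indicator ?Q x
          \<le> ennreal (norm (f x - ?c)) * indicator ?Q x + ennreal (F * ?w) * indicator ?Q x"
      proof (cases "x \<in> ?Q")
        case True
        have "norm (f x - g x) \<le> norm (f x - ?c) + F * ?w"
          using norm_diff_triangle_le[of "f x" ?c _ "g x"] F(2)[OF True] by (simp add: norm_minus_commute)
        with True show ?thesis
          using F(1) w by (simp add: ennreal_leI flip: ennreal_plus)
      qed simp
    qed
    also have "\<dots> = (\<integral>\<^sup>+x\<in>?Q. ennreal (norm (f x - ?c)) \<partial>lebesgue) + (\<integral>\<^sup>+x\<in>?Q. ennreal (F * ?w) \<partial>lebesgue)"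
      by (intro nn_integral_add fc borel_measurable_times_ennreal borel_measurable_const
          borel_measurable_indicator) simp
    also have "\<dots> \<le> ennreal (B * ?w * ?V) + ennreal (F * ?w * ?V)"
      using F(1) w by (intro add_mono osc nn_integral_cube_le) auto
    also have "\<dots> = ennreal ((B + F) * ?w * ?V)"
      using B(1) F(1) w by (simp add: algebra_simps flip: ennreal_plus)
    finally show ?thesis .
  qed
  have "AE x in lebesgue. x \<in> cube a 1 \<longrightarrow> f x = g x" for a
  proof -
    let ?J = "\<integral>\<^sup>+x\<in>cube a 1. ennreal (norm (f x - g x)) \<partial>lebesgue"
    have "?J \<le> ennreal ((B + F) * \<omega> (2 * (1 / 2 ^ k)))" for k
      using B(1) F(1) \<omega>_pos[of "2 * (1 / 2 ^ k)"] meas le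
      by (intro nn_integral_unit_cube_le_subdivision[where k=k]) auto
    moreover have "(\<lambda>k. ennreal ((B + F) * \<omega> (2 * (1 / 2 ^ k)))) \<longlonglongrightarrow> ennreal 0"
      by (intro tendsto_intros lim)
    ultimately have "?J \<le> ennreal 0"
      by (intro LIMSEQ_le_const) auto
    then have "(\<integral>\<^sup>+x. ennreal (norm (f x - g x)) \<partial>lebesgue_on (cube a 1)) = 0"
      by (simp add: nn_integral_lebesgue_on_cube)
    then have "AE x in lebesgue_on (cube a 1). ennreal (norm (f x - g x)) = 0"
      using meas by (simp add: nn_integral_0_iff_AE)
    then show ?thesis
      by (subst (asm) AE_restrict_space_iff) (auto simp: ennreal_eq_0_iff)
  qed
  then have "ae_rep f g"
    unfolding ae_rep_def by (rule AE_lebesgue_if_AE_unit_cubes)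
  with gc show ?thesis by (rule that)
qed

section \<open>The vanishing Hoelder conditions with real numbers\<close>

lemma holder_osc_le_iff:
  "x \<noteq> y \<Longrightarrow> e \<ge> 0 \<Longrightarrow>
    holder_osc \<omega> g x y \<le> ennreal e \<longleftrightarrow> norm (g x - g y) \<le> e * \<omega> (norm (x - y))"
  using \<omega>_pos[of "norm (x - y)"] by (simp add: holder_osc_def ennreal_le_iff divide_le_eq)

lemma SUP_holder_osc_le_iff:
  assumes "\<delta> > 0" "e \<ge> 0"
  shows "(SUP (x, y)\<in>{(x, y). norm (x - y) = \<delta>}. holder_osc \<omega> g x y) \<le> ennreal e
    \<longleftrightarrow> (\<forall>x y. norm (x - y) = \<delta> \<longrightarrow> norm (g x - g y) \<le> e * \<omega> (norm (x - y)))"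
proof -
  have "(SUP (x, y)\<in>{(x, y). norm (x - y) = \<delta>}. holder_osc \<omega> g x y) \<le> ennreal e
      \<longleftrightarrow> (\<forall>x y. norm (x - y) = \<delta> \<longrightarrow> holder_osc \<omega> g x y \<le> ennreal e)"
    by (auto simp: SUP_le_iff)
  also have "\<dots> \<longleftrightarrow> (\<forall>x y. norm (x - y) = \<delta> \<longrightarrow> norm (g x - g y) \<le> e * \<omega> (norm (x - y)))"
  proof (intro all_cong1 imp_cong refl)
    fix x y :: 'a assume "norm (x - y) = \<delta>"
    then have "x \<noteq> y" using assms by auto
    then show "holder_osc \<omega> g x y \<le> ennreal e \<longleftrightarrow> norm (g x - g y) \<le> e * \<omega> (norm (x - y))"
      using assms by (intro holder_osc_le_iff)
  qed
  finally show ?thesis .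
qed

lemma VC_small_iff:
  "g \<in> VC_small \<omega> \<longleftrightarrow> g \<in> holder_space \<omega> \<and>
    (\<forall>e>0. \<exists>d>0. \<forall>x y. x \<noteq> y \<and> norm (x - y) < d \<longrightarrow> norm (g x - g y) \<le> e * \<omega> (norm (x - y)))"
  (is "_ \<longleftrightarrow> _ \<and> (\<forall>e>0. ?P e)")
proof -
  have "?P e \<longleftrightarrow> (\<forall>\<^sub>F \<delta> in at_right 0. (SUP (x, y)\<in>{(x, y). norm (x - y) = \<delta>}. holder_osc \<omega> g x y) \<le> ennreal e)"
    if "e > 0" for e
  proof -
    have *: "(SUP (x, y)\<in>{(x, y). norm (x - y) = \<delta>}. holder_osc \<omega> g x y) \<le> ennreal e
      \<longleftrightarrow> (\<forall>x y. norm (x - y) = \<delta> \<longrightarrow> norm (g x - g y) \<le> e * \<omega> (norm (x - y)))" if "\<delta> > 0" for \<delta>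
      using that \<open>e > 0\<close> by (intro SUP_holder_osc_le_iff) auto
    show ?thesis
      unfolding eventually_at_right_field
    proof (intro ex_cong1 conj_cong refl)
      fix d :: real
      show "(\<forall>x y. x \<noteq> y \<and> norm (x - y) < d \<longrightarrow> norm (g x - g y) \<le> e * \<omega> (norm (x - y))) \<longleftrightarrow>
        (\<forall>\<delta>>0. \<delta> < d \<longrightarrow> (SUP (x, y)\<in>{(x, y). norm (x - y) = \<delta>}. holder_osc \<omega> g x y) \<le> ennreal e)"
        using * by (auto simp del: SUP_le_iff)
    qed
  qed
  then show ?thesis
    by (simp add: VC_small_def tendsto_0_ennreal_iff)
qed

lemma VC_large_iff:
  "g \<in> VC_large \<omega> \<longleftrightarrow> g \<in> holder_space \<omega> \<and>
    (\<forall>e>0. \<exists>d>0. \<forall>x y. d < norm (x - y) \<longrightarrow> norm (g x - g y) \<le> e * \<omega> (norm (x - y)))"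
  (is "_ \<longleftrightarrow> _ \<and> (\<forall>e>0. ?P e)")
proof -
  have "?P e \<longleftrightarrow> (\<forall>\<^sub>F \<delta> in at_top. (SUP (x, y)\<in>{(x, y). norm (x - y) = \<delta>}. holder_osc \<omega> g x y) \<le> ennreal e)"
    (is "_ \<longleftrightarrow> (\<forall>\<^sub>F \<delta> in at_top. ?Q \<delta>)") if "e > 0" for e
  proof -
    have *: "?Q \<delta> \<longleftrightarrow> (\<forall>x y. norm (x - y) = \<delta> \<longrightarrow> norm (g x - g y) \<le> e * \<omega> (norm (x - y)))" if "\<delta> > 0" for \<delta>
      using that \<open>e > 0\<close> by (intro SUP_holder_osc_le_iff) auto
    show ?thesis
    proof
      assume "?P e"
      then obtain d where d: "d > 0"
        "\<forall>x y. d < norm (x - y) \<longrightarrow> norm (g x - g y) \<le> e * \<omega> (norm (x - y))" by blast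
      have "?Q \<delta>" if "\<delta> > d" for \<delta>
        using d that by (subst *) auto
      then show "\<forall>\<^sub>F \<delta> in at_top. ?Q \<delta>"
        unfolding eventually_at_top_dense by blast
    next
      assume "\<forall>\<^sub>F \<delta> in at_top. ?Q \<delta>"
      then obtain N where N: "\<And>\<delta>. \<delta> > N \<Longrightarrow> ?Q \<delta>"
        unfolding eventually_at_top_dense by blast
      have "norm (g x - g y) \<le> e * \<omega> (norm (x - y))" if "max N 1 < norm (x - y)" for x y
      proof -
        have "norm (x - y) > 0" "norm (x - y) > N" using that by linarith+
        then show ?thesis using N *[of "norm (x - y)"] by blast
      qed
      then show "?P e"
        by (intro exI[of _ "max N 1"]) auto
    qed
  qed
  then show ?thesis
    by (simp add: VC_large_def tendsto_0_ennreal_iff)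
qed

lemma VC_far_iff:
  "g \<in> VC_far \<omega> \<longleftrightarrow> g \<in> holder_space \<omega> \<and>
    (\<forall>e>0. \<exists>d>0. \<forall>x y. x \<noteq> y \<and> d < norm x \<and> d < norm y \<longrightarrow>
      norm (g x - g y) \<le> e * \<omega> (norm (x - y)))"
  (is "_ \<longleftrightarrow> _ \<and> (\<forall>e>0. ?P e)")
proof -
  have "?P e \<longleftrightarrow> (\<forall>\<^sub>F \<delta> in at_top.
      (SUP (x, y)\<in>{(x, y). x \<noteq> y \<and> min (norm x) (norm y) > \<delta>}. holder_osc \<omega> g x y) \<le> ennreal e)"
    (is "_ \<longleftrightarrow> (\<forall>\<^sub>F \<delta> in at_top. ?Q \<delta>)") if "e > 0" for e
  proof -
    have *: "?Q \<delta> \<longleftrightarrow> (\<forall>x y. x \<noteq> y \<and> \<delta> < norm x \<and> \<delta> < norm y \<longrightarrow>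
        norm (g x - g y) \<le> e * \<omega> (norm (x - y)))" for \<delta>
      using holder_osc_le_iff[of _ _ e g] \<open>e > 0\<close> by (auto simp: SUP_le_iff)
    show ?thesis
    proof
      assume "?P e"
      then show "\<forall>\<^sub>F \<delta> in at_top. ?Q \<delta>"
        unfolding eventually_at_top_dense * by (blast intro: less_trans)
    next
      assume "\<forall>\<^sub>F \<delta> in at_top. ?Q \<delta>"
      then obtain N where N: "\<And>\<delta>. \<delta> > N \<Longrightarrow> ?Q \<delta>"
        unfolding eventually_at_top_dense by blast
      have "?Q (max N 0 + 1)" by (rule N) linarith
      then show "?P e"
        unfolding * by (intro exI[of _ "max N 0 + 1"]) auto
    qed
  qed
  then show ?thesis
    by (simp add: VC_far_def tendsto_0_ennreal_iff)
qed

subsection \<open>From Hoelder functions to mean oscillation\<close>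

lemma mean_osc_le_sup:
  fixes g :: "real^'n \<Rightarrow> 'b::banach"
  assumes g: "g \<in> L1_loc" and l: "l > 0" and m: "m \<ge> 0"
    and le: "\<And>x y. x \<in> cube a l \<Longrightarrow> y \<in> cube a l \<Longrightarrow> norm (g x - g y) \<le> m * \<omega> l"
  shows "mean_osc \<omega> g a l \<le> ennreal m"
proof -
  have M: "m * \<omega> l \<ge> 0" using m \<omega>_pos[OF l] by simp
  have "norm (g x - banach_average (cube a l) g) \<le> m * \<omega> l" if "x \<in> cube a l" for x
    using norm_average_diff_le_sup[OF g l M le[OF _ that]] by (simp add: norm_minus_commute)
  then show ?thesis
    using l M by (subst mean_osc_le_iff[where \<omega>=\<omega>, OF l \<omega>_pos[OF l] m]) (intro nn_integral_cube_le, auto)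
qed

lemma \<omega>_cube_diff_le:
  fixes x y :: "real^'n"
  assumes "x \<in> cube a l" "y \<in> cube a l" "x \<noteq> y"
  shows "\<omega> (norm (x - y)) \<le> Cdb ^ CARD('n) * \<omega> l"
proof -
  have le: "norm (x - y) \<le> 2 ^ CARD('n) * l" by (intro norm_cube_diff_le[OF assms(1,2)])
  moreover have "0 < norm (x - y)" using assms(3) by simp
  ultimately have "0 < 2 ^ CARD('n) * l" by linarith
  then have "l > 0" by (simp add: zero_less_mult_iff)
  have "\<omega> (norm (x - y)) \<le> \<omega> (2 ^ CARD('n) * l)"
    using le assms(3) by (intro \<omega>_mono) auto
  also have "\<dots> \<le> Cdb ^ CARD('n) * \<omega> l"
    by (intro \<omega>_double_power \<open>l > 0\<close>)
  finally show ?thesis .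
qed

text \<open>The second alternative serves \<open>VC_large\<close>: nearby points of a large cube
  have no small Hoelder quotient, but their difference is small relative to
  \<open>\<omega> l\<close>.\<close>

lemma mean_osc_le_if_holder_on_cube:
  fixes g :: "real^'n \<Rightarrow> 'b::banach"
  assumes g: "g \<in> L1_loc" and l: "l > 0" and m: "m \<ge> 0"
    and le: "\<And>x y. x \<in> cube a l \<Longrightarrow> y \<in> cube a l \<Longrightarrow> x \<noteq> y \<Longrightarrow>
      norm (g x - g y) \<le> m * \<omega> (norm (x - y)) \<or> norm (g x - g y) \<le> m * Cdb ^ CARD('n) * \<omega> l"
  shows "mean_osc \<omega> g a l \<le> ennreal (m * Cdb ^ CARD('n))"
proof (rule mean_osc_le_sup[OF g l])
  show "0 \<le> m * Cdb ^ CARD('n)" using m Cdb_gt_1 by simp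
  fix x y assume xy: "x \<in> cube a l" "y \<in> cube a l"
  show "norm (g x - g y) \<le> m * Cdb ^ CARD('n) * \<omega> l"
  proof (cases "x = y")
    case True
    then show ?thesis using m Cdb_gt_1 \<omega>_pos[OF l] by simp
  next
    case False
    show ?thesis
      using le[OF xy False] mult_left_mono[OF \<omega>_cube_diff_le[OF xy False] m] by (auto simp: mult.assoc)
  qed
qed

lemma bmo_norm_le_holder_norm:
  fixes g :: "real^'n \<Rightarrow> 'b::banach"
  assumes g: "g \<in> holder_space \<omega>"
  shows "bmo_norm \<omega> g \<le> ennreal (const_bmo_le_holder CARD('n) Cdb) * holder_norm \<omega> g"
proof -
  obtain H where H: "H \<ge> 0" "holder_norm \<omega> g = ennreal H"
    "\<And>x y. x \<noteq> y \<Longrightarrow> norm (g x - g y) \<le> H * \<omega> (norm (x - y))"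
    using holder_spaceE[OF g] by metis
  have "mean_osc \<omega> g a l \<le> ennreal (H * Cdb ^ CARD('n))" if "l > 0" for a l
    using H(3) by (intro mean_osc_le_if_holder_on_cube continuous_imp_L1_loc continuous_holder g that H(1)) auto
  then have "bmo_norm \<omega> g \<le> ennreal (H * Cdb ^ CARD('n))"
    by (auto simp: bmo_norm_def SUP_le_iff)
  then show ?thesis
    using H Cdb_gt_1 by (simp add: const_bmo_le_holder_def ennreal_mult mult.commute)
qed

lemma holder_imp_BMO:
  fixes g :: "real^'n \<Rightarrow> 'b::banach"
  assumes g: "g \<in> holder_space \<omega>"
  shows "g \<in> BMO \<omega>"
proof -
  have "ennreal (const_bmo_le_holder CARD('n) Cdb) * holder_norm \<omega> g < \<infinity>"
    using g by (simp add: holder_space_def ennreal_mult_less_top)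
  then show ?thesis
    using le_less_trans[OF bmo_norm_le_holder_norm[OF g]] continuous_imp_L1_loc[OF continuous_holder[OF g]]
    by (simp add: BMO_def)
qed

subsection \<open>From mean oscillation to Hoelder functions\<close>

text \<open>Only cubes of side at most \<open>norm (x - y)\<close> enter the chain, so the lemma
  serves \<open>BMO\<close> and \<open>VMO_small\<close> alike.\<close>

lemma norm_diff_le_mean_osc:
  fixes g :: "real^'n \<Rightarrow> 'b::banach"
  assumes g: "continuous_on UNIV g" and B: "B \<ge> 0" "\<And>a l. l > 0 \<Longrightarrow> l \<le> norm (x - y) \<Longrightarrow> mean_osc \<omega> g a l \<le> ennreal B"
    and xy: "x \<noteq> y"
  shows "norm (g x - g y) \<le> 2 ^ (CARD('n) + 1) * B * (1 + 2 * D) * \<omega> (norm (x - y))"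
proof -
  obtain a where a: "x \<in> cube a (norm (x - y))" "y \<in> cube a (norm (x - y))"
    by (rule common_cube)
  have "norm (x - y) / 2 ^ k \<le> norm (x - y)" for k
    by (simp add: divide_le_eq mult_le_cancel_left1)
  then show ?thesis
    using xy by (intro norm_diff_le_telescope[OF g _ B(1) a] B(2)) auto
qed

lemma BMO_imp_holder:
  fixes g :: "real^'n \<Rightarrow> 'b::banach"
  assumes g: "continuous_on UNIV g" "g \<in> BMO \<omega>"
  shows "g \<in> holder_space \<omega>"
    and "holder_norm \<omega> g \<le> ennreal (const_holder_le_bmo CARD('n)) * dini_const \<omega> * bmo_norm \<omega> g"
proof -
  obtain B where B: "B \<ge> 0" "bmo_norm \<omega> g = ennreal B" "\<And>a l. l > 0 \<Longrightarrow> mean_osc \<omega> g a l \<le> ennreal B"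
    using bmo_normE[OF g(2)] by metis
  have le: "norm (g x - g y) \<le> 2 ^ (CARD('n) + 1) * B * (1 + 2 * D) * \<omega> (norm (x - y))" if "x \<noteq> y" for x y
    using B by (intro norm_diff_le_mean_osc g(1) that) auto
  \<comment> \<open>Membership comes first, from the bound with \<open>1 + 2 * D\<close>, because
    the constancy result for \<open>D < 1/2\<close> speaks of Hoelder functions only.\<close>
  show gH: "g \<in> holder_space \<omega>"
    using B(1) D_nonneg by (intro holder_spaceI[OF le]) auto
  have "norm (g x - g y) \<le> (2 ^ (CARD('n) + 3) * D * B) * \<omega> (norm (x - y))" if xy: "x \<noteq> y" for x y
  proof (cases "D < 1/2")
    case True
    then show ?thesis
      using holder_const_if_D_small[OF gH True, of x y] B(1) D_nonneg \<omega>_pos[of "norm (x - y)"] xy by simp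
  next
    case False
    have "norm (g x - g y) \<le> 2 ^ (CARD('n) + 1) * B * (1 + 2 * D) * \<omega> (norm (x - y))"
      by (rule le[OF xy])
    \<comment> \<open>Here \<open>1 + 2 * D \<le> 4 * D\<close>; the factor 4 raises the exponent
      from \<open>n + 1\<close> to \<open>n + 3\<close>.\<close>
    also have "\<dots> \<le> 2 ^ (CARD('n) + 1) * B * (4 * D) * \<omega> (norm (x - y))"
      using False B(1) \<omega>_pos[of "norm (x - y)"] xy by (intro mult_right_mono mult_left_mono) auto
    also have "\<dots> = (2 ^ (CARD('n) + 3) * D * B) * \<omega> (norm (x - y))"
      by (simp add: power_add)
    finally show ?thesis .
  qed
  then have "holder_norm \<omega> g \<le> ennreal (2 ^ (CARD('n) + 3) * D * B)"
    using B(1) D_nonneg by (subst holder_norm_le_iff) auto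
  then show "holder_norm \<omega> g \<le> ennreal (const_holder_le_bmo CARD('n)) * dini_const \<omega> * bmo_norm \<omega> g"
    using B D_nonneg by (simp add: dini const_holder_le_bmo_def ennreal_mult)
qed

subsection \<open>The vanishing subspaces\<close>

lemma VC_small_imp_VMO_small:
  fixes g :: "real^'n \<Rightarrow> 'b::banach"
  assumes "g \<in> VC_small \<omega>"
  shows "g \<in> VMO_small \<omega>"
  unfolding VMO_small_iff
proof (intro conjI allI impI)
  have g: "g \<in> holder_space \<omega>" using assms by (simp add: VC_small_iff)
  then show "g \<in> BMO \<omega>" by (rule holder_imp_BMO)
  fix e :: real assume e: "e > 0"
  \<comment> \<open>Dividing by \<open>Cdb ^ n\<close> compensates for the doublings spent on the
    diameter of the cube.\<close>
  define m where "m = e / Cdb ^ CARD('n)"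
  have m: "m > 0" "m * Cdb ^ CARD('n) = e" using e Cdb_gt_1 by (auto simp: m_def)
  obtain d where d: "d > 0" "\<And>x y. x \<noteq> y \<Longrightarrow> norm (x - y) < d \<Longrightarrow> norm (g x - g y) \<le> m * \<omega> (norm (x - y))"
    using assms m(1) unfolding VC_small_iff by metis
  show "\<exists>d>0. \<forall>a l. 0 < l \<and> l < d \<longrightarrow> mean_osc \<omega> g a l \<le> ennreal e"
  proof (intro exI[of _ "d / 2 ^ CARD('n)"] conjI allI impI)
    fix a :: "real^'n" and l :: real
    assume l: "0 < l \<and> l < d / 2 ^ CARD('n)"
    have "mean_osc \<omega> g a l \<le> ennreal (m * Cdb ^ CARD('n))"
    proof (rule mean_osc_le_if_holder_on_cube[OF continuous_imp_L1_loc[OF continuous_holder[OF g]]])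
      fix x y assume xy: "x \<in> cube a l" "y \<in> cube a l" "x \<noteq> y"
      have "norm (x - y) < d"
        using norm_cube_diff_le[OF xy(1,2)] l by (simp add: field_simps)
      then show "norm (g x - g y) \<le> m * \<omega> (norm (x - y)) \<or> norm (g x - g y) \<le> m * Cdb ^ CARD('n) * \<omega> l"
        using d(2) xy(3) by blast
    qed (use l m in auto)
    then show "mean_osc \<omega> g a l \<le> ennreal e" by (simp add: m(2))
  qed (use d in simp)
qed

lemma VC_far_imp_VMO_far:
  fixes g :: "real^'n \<Rightarrow> 'b::banach"
  assumes "g \<in> VC_far \<omega>"
  shows "g \<in> VMO_far \<omega>"
  unfolding VMO_far_iff
proof (intro conjI allI impI)
  have g: "g \<in> holder_space \<omega>" using assms by (simp add: VC_far_iff)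
  then show "g \<in> BMO \<omega>" by (rule holder_imp_BMO)
  fix e :: real assume e: "e > 0"
  define m where "m = e / Cdb ^ CARD('n)"
  have m: "m > 0" "m * Cdb ^ CARD('n) = e" using e Cdb_gt_1 by (auto simp: m_def)
  obtain d where d: "d > 0" "\<And>x y. x \<noteq> y \<Longrightarrow> d < norm x \<Longrightarrow> d < norm y \<Longrightarrow> norm (g x - g y) \<le> m * \<omega> (norm (x - y))"
    using assms m(1) unfolding VC_far_iff by metis
  show "\<exists>d>0. \<forall>a l. 0 < l \<and> (\<forall>z\<in>cube a l. d < norm z) \<longrightarrow> mean_osc \<omega> g a l \<le> ennreal e"
  proof (intro exI[of _ d] conjI allI impI)
    fix a :: "real^'n" and l :: real
    assume l: "0 < l \<and> (\<forall>z\<in>cube a l. d < norm z)"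
    have "mean_osc \<omega> g a l \<le> ennreal (m * Cdb ^ CARD('n))"
    proof (rule mean_osc_le_if_holder_on_cube[OF continuous_imp_L1_loc[OF continuous_holder[OF g]]])
      fix x y assume xy: "x \<in> cube a l" "y \<in> cube a l" "x \<noteq> y"
      then show "norm (g x - g y) \<le> m * \<omega> (norm (x - y)) \<or> norm (g x - g y) \<le> m * Cdb ^ CARD('n) * \<omega> l"
        using d(2) l by blast
    qed (use l m in auto)
    then show "mean_osc \<omega> g a l \<le> ennreal e" by (simp add: m(2))
  qed (use d in simp)
qed

lemma \<omega>_eventually_ge:
  assumes "filterlim \<omega> at_top at_top"
  obtains L where "L > 0" "\<And>t. t \<ge> L \<Longrightarrow> M \<le> \<omega> t"
proof -
  obtain N where N: "\<And>t. t \<ge> N \<Longrightarrow> M \<le> \<omega> t"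
    using assms unfolding filterlim_at_top eventually_at_top_linorder by blast
  show ?thesis by (rule that[of "max N 1"]) (auto intro: N)
qed

text \<open>A large cube contains pairs at distance at most \<open>d\<close>, about which the
  hypothesis says nothing. Their values differ by at most the fixed amount
  \<open>H * \<omega> d\<close>, which is below \<open>e * \<omega> l\<close> once \<open>l\<close>
  is large.\<close>

lemma VC_large_imp_VMO_large:
  fixes g :: "real^'n \<Rightarrow> 'b::banach"
  assumes "g \<in> VC_large \<omega>" and lim: "filterlim \<omega> at_top at_top"
  shows "g \<in> VMO_large \<omega>"
  unfolding VMO_large_iff
proof (intro conjI allI impI)
  have g: "g \<in> holder_space \<omega>" using assms by (simp add: VC_large_iff)
  then show "g \<in> BMO \<omega>" by (rule holder_imp_BMO)
  obtain H where H: "H \<ge> 0"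
    "\<And>x y d. 0 < d \<Longrightarrow> norm (x - y) \<le> d \<Longrightarrow> norm (g x - g y) \<le> H * \<omega> d"
    using holder_spaceE[OF g] by metis
  fix e :: real assume e: "e > 0"
  define m where "m = e / Cdb ^ CARD('n)"
  have m: "m > 0" "m * Cdb ^ CARD('n) = e" using e Cdb_gt_1 by (auto simp: m_def)
  obtain d where d: "d > 0" "\<And>x y. d < norm (x - y) \<Longrightarrow> norm (g x - g y) \<le> m * \<omega> (norm (x - y))"
    using assms m(1) unfolding VC_large_iff by metis
  obtain L where L: "L > 0" "\<And>t. t \<ge> L \<Longrightarrow> H * \<omega> d / e \<le> \<omega> t"
    using \<omega>_eventually_ge[OF lim] by metis
  show "\<exists>d>0. \<forall>a l. d < l \<longrightarrow> mean_osc \<omega> g a l \<le> ennreal e"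
  proof (intro exI[of _ L] conjI allI impI)
    fix a :: "real^'n" and l :: real
    assume l: "L < l"
    have "mean_osc \<omega> g a l \<le> ennreal (m * Cdb ^ CARD('n))"
    proof (rule mean_osc_le_if_holder_on_cube[OF continuous_imp_L1_loc[OF continuous_holder[OF g]]])
      fix x y
      show "norm (g x - g y) \<le> m * \<omega> (norm (x - y)) \<or> norm (g x - g y) \<le> m * Cdb ^ CARD('n) * \<omega> l"
      proof (cases "d < norm (x - y)")
        case False
        then have "norm (g x - g y) \<le> H * \<omega> d" using H(2)[OF d(1)] by simp
        also have "\<dots> \<le> e * \<omega> l" using L(2)[of l] l e by (simp add: field_simps)
        finally show ?thesis by (simp add: m(2))
      qed (use d in blast)
    qed (use l L m in auto)
    then show "mean_osc \<omega> g a l \<le> ennreal e" by (simp add: m(2))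
  qed (use L in simp)
qed

lemma telescope_scale:
  assumes "e > 0"
  obtains m where "m > 0" "2 ^ n * m * (1 + 2 * D) = e"
proof
  have "1 + 2 * D > 0" using D_nonneg by simp
  then show "e / (2 ^ n * (1 + 2 * D)) > 0" "2 ^ n * (e / (2 ^ n * (1 + 2 * D))) * (1 + 2 * D) = e"
    using assms by (simp_all add: nonzero_mult_div_cancel_left)
qed

lemma VMO_small_imp_VC_small:
  fixes g :: "real^'n \<Rightarrow> 'b::banach"
  assumes "g \<in> VMO_small \<omega>" and g: "g \<in> holder_space \<omega>"
  shows "g \<in> VC_small \<omega>"
  unfolding VC_small_iff
proof (intro conjI allI impI g)
  fix e :: real assume e: "e > 0"
  obtain m where m: "m > 0" "2 ^ (CARD('n) + 1) * m * (1 + 2 * D) = e"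
    using telescope_scale[of "e" "CARD('n) + 1"] e by auto
  obtain d where d: "d > 0" "\<And>a l. 0 < l \<Longrightarrow> l < d \<Longrightarrow> mean_osc \<omega> g a l \<le> ennreal m"
    using assms(1) m(1) unfolding VMO_small_iff by metis
  have "norm (g x - g y) \<le> e * \<omega> (norm (x - y))" if "x \<noteq> y" "norm (x - y) < d" for x y
    using norm_diff_le_mean_osc[OF continuous_holder[OF g], of m x y] that m d by simp
  with d(1) show "\<exists>d>0. \<forall>x y. x \<noteq> y \<and> norm (x - y) < d \<longrightarrow> norm (g x - g y) \<le> e * \<omega> (norm (x - y))"
    by blast
qed

text \<open>Halving runs while the side exceeds \<open>d\<close>. The remainder is a Hoelder
  difference at a scale comparable to \<open>d\<close>, hence bounded independently of
  \<open>norm (x - y)\<close>.\<close>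

lemma VMO_large_imp_VC_large:
  fixes g :: "real^'n \<Rightarrow> 'b::banach"
  assumes "g \<in> VMO_large \<omega>" and g: "g \<in> holder_space \<omega>" and lim: "filterlim \<omega> at_top at_top"
  shows "g \<in> VC_large \<omega>"
  unfolding VC_large_iff
proof (intro conjI allI impI g)
  obtain H where H: "H \<ge> 0"
    "\<And>x y d. 0 < d \<Longrightarrow> norm (x - y) \<le> d \<Longrightarrow> norm (g x - g y) \<le> H * \<omega> d"
    using holder_spaceE[OF g] by metis
  fix e :: real assume e: "e > 0"
  obtain m where m: "m > 0" "2 ^ (CARD('n) + 1) * m * (1 + 2 * D) = e / 2"
    using telescope_scale[of "e / 2" "CARD('n) + 1"] e by auto
  obtain d where d: "d > 0" "\<And>a l. d < l \<Longrightarrow> mean_osc \<omega> g a l \<le> ennreal m"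
    using assms(1) m(1) unfolding VMO_large_iff by metis
  \<comment> \<open>The remainder is at most \<open>2 * H * \<omega> (2 ^ n * d)\<close>; this
    threshold makes it at most \<open>e / 2 * \<omega> l\<close>.\<close>
  obtain L where L: "L > 0" "\<And>t. t \<ge> L \<Longrightarrow> 4 * H * \<omega> (2 ^ CARD('n) * d) / e \<le> \<omega> t"
    using \<omega>_eventually_ge[OF lim] by metis
  have "norm (g x - g y) \<le> e * \<omega> (norm (x - y))" if xy: "L < norm (x - y)" for x y
  proof -
    define l where "l = norm (x - y)"
    have l: "l > L" "l > 0" using xy L(1) by (auto simp: l_def)
    obtain K0 where "l / d < 2 ^ K0"
      using real_arch_pow[of 2] by auto
    then have K0: "l / 2 ^ K0 \<le> d"
      using d(1) by (simp add: field_simps)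
    \<comment> \<open>By minimality every cube used in the chain still has side above
      \<open>d\<close>, while the last one has side at most \<open>d\<close>.\<close>
    define K where "K = (LEAST k. l / 2 ^ k \<le> d)"
    have K: "l / 2 ^ K \<le> d" unfolding K_def by (rule LeastI[of _ K0]) (rule K0)
    have K': "d < l / 2 ^ k" if "k < K" for k
      using not_less_Least[of k "\<lambda>k. l / 2 ^ k \<le> d"] that by (simp add: K_def)
    obtain a where a: "x \<in> cube a l" "y \<in> cube a l"
      unfolding l_def by (rule common_cube)
    have "norm (g x - g y) \<le> 2 ^ (CARD('n) + 1) * m * (1 + 2 * D) * \<omega> l
        + 2 * H * \<omega> (2 ^ CARD('n) * (l / 2 ^ K))"
    proof (rule norm_diff_le_telescope_finite[OF continuous_imp_L1_loc[OF continuous_holder[OF g]] H(2) H(1) l(2) _ a])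
      show "mean_osc \<omega> g b (l / 2 ^ k) \<le> ennreal m" if "k < K" for b k
        by (intro d(2) K' that)
    qed (use m in auto)
    also have "2 * H * \<omega> (2 ^ CARD('n) * (l / 2 ^ K)) \<le> 2 * H * \<omega> (2 ^ CARD('n) * d)"
      using H(1) K l(2) by (intro mult_left_mono \<omega>_mono) auto
    also have "\<dots> \<le> e / 2 * \<omega> l"
      using L(2)[of l] l(1) e by (simp add: field_simps)
    finally show ?thesis
      unfolding m(2) l_def[symmetric] by simp
  qed
  with L(1) show "\<exists>d>0. \<forall>x y. d < norm (x - y) \<longrightarrow> norm (g x - g y) \<le> e * \<omega> (norm (x - y))"
    by blast
qed

text \<open>A point \<open>x\<close> is joined to a corner \<open>p\<close> of its orthant, at distance comparable to \<open>d\<close> from the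
  origin, inside a cube that stays in that orthant and hence away from the origin.\<close>

lemma norm_diff_corner_le:
  fixes g :: "real^'n \<Rightarrow> 'b::banach"
  assumes g: "continuous_on UNIV g" and d: "d > 0" and m: "m \<ge> 0" and l: "l > 0" "norm x \<le> l"
    and osc: "\<And>a l. 0 < l \<Longrightarrow> (\<forall>z\<in>cube a l. d < norm z) \<Longrightarrow> mean_osc \<omega> g a l \<le> ennreal m"
  obtains p where "p \<in> cube (\<chi> i. - (2 * d)) (4 * d)"
    "norm (g (x + p) - g p) \<le> 2 ^ (CARD('n) + 1) * m * (1 + 2 * D) * \<omega> l"
proof
  \<comment> \<open>Since \<open>x\<close> may lie near a coordinate hyperplane, it is
    \<open>x + p\<close> that is joined to \<open>p\<close>: the shift keeps each sign and brings
    each coordinate to absolute value at least \<open>2 * d\<close>. The cube at \<open>a\<close>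
    extends outwards from \<open>p\<close>, so all its points have this property.\<close>
  define p :: "real^'n" where "p = (\<chi> i. if x $ i \<ge> 0 then 2 * d else - (2 * d))"
  define a :: "real^'n" where "a = (\<chi> i. if x $ i \<ge> 0 then 2 * d else - (2 * d) - l)"
  show "p \<in> cube (\<chi> i. - (2 * d)) (4 * d)"
    unfolding mem_cube_iff p_def using d by auto
  have xi: "\<bar>x $ i\<bar> \<le> l" for i
    using component_le_norm_cart[of x i] l(2) by linarith
  have xp: "x + p \<in> cube a l" "p \<in> cube a l"
  proof -
    have "a $ i \<le> (x + p) $ i \<and> (x + p) $ i \<le> a $ i + l \<and> a $ i \<le> p $ i \<and> p $ i \<le> a $ i + l" for i
      using xi[of i] l(1) by (auto simp: p_def a_def)
    then show "x + p \<in> cube a l" "p \<in> cube a l" by (auto simp: mem_cube_iff)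
  qed
  have away: "d < norm z" if "z \<in> cube a l" for z
  proof -
    fix i :: 'n
    have "2 * d \<le> \<bar>z $ i\<bar>"
      using that[unfolded mem_cube_iff, rule_format, of i] l(1) d by (auto simp: a_def split: if_splits)
    then show ?thesis using component_le_norm_cart[of z i] d by linarith
  qed
  show "norm (g (x + p) - g p) \<le> 2 ^ (CARD('n) + 1) * m * (1 + 2 * D) * \<omega> l"
  proof (rule norm_diff_le_telescope[OF g l(1) m xp])
    fix b k assume "cube b (l / 2 ^ k) \<subseteq> cube a l"
    then show "mean_osc \<omega> g b (l / 2 ^ k) \<le> ennreal m"
      using away l(1) by (intro osc) auto
  qed
qed

text \<open>If \<open>norm (x - y)\<close> is small compared with \<open>norm x\<close>, a common
  cube avoids the ball of radius \<open>d\<close> and telescoping suffices. Otherwise the path is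
  \<open>x\<close>, \<open>x + p\<close>, \<open>p\<close>, \<open>q\<close>, \<open>y + q\<close>,
  \<open>y\<close>, with corners \<open>p\<close> and \<open>q\<close> of the orthants of
  \<open>x\<close> and \<open>y\<close>. The two long steps telescope away from the origin; the
  three short ones have bounded cost, and \<open>norm (x - y)\<close> is large enough to absorb
  it.\<close>

lemma VMO_far_imp_VC_far:
  fixes g :: "real^'n \<Rightarrow> 'b::banach"
  assumes "g \<in> VMO_far \<omega>" and g: "g \<in> holder_space \<omega>" and lim: "filterlim \<omega> at_top at_top"
  shows "g \<in> VC_far \<omega>"
  unfolding VC_far_iff
proof (intro conjI allI impI g)
  have gc: "continuous_on UNIV g" by (rule continuous_holder[OF g])
  obtain H where H: "H \<ge> 0"
    "\<And>x y d. 0 < d \<Longrightarrow> norm (x - y) \<le> d \<Longrightarrow> norm (g x - g y) \<le> H * \<omega> d"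
    using holder_spaceE[OF g] by metis
  fix e :: real assume e: "e > 0"
  \<comment> \<open>The long steps are measured at scale \<open>l = 2 ^ (n + 2) * r\<close>; this is
    the price of returning to \<open>\<omega> r\<close>.\<close>
  define C where "C = Cdb ^ (CARD('n) + 2)"
  have C: "C \<ge> 1" unfolding C_def using Cdb_gt_1 by (intro one_le_power) simp
  obtain m where m: "m > 0" "2 ^ (CARD('n) + 1) * m * (1 + 2 * D) = e / (4 * C)"
    using telescope_scale[of "e / (4 * C)" "CARD('n) + 1"] e C by auto
  obtain d where d: "d > 0"
    "\<And>a l. 0 < l \<Longrightarrow> (\<forall>z\<in>cube a l. d < norm z) \<Longrightarrow> mean_osc \<omega> g a l \<le> ennreal m"
    using assms(1) m(1) unfolding VMO_far_iff by metis
  \<comment> \<open>A bound for the diameter of the cube with corners at coordinates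
    \<open>2 * d\<close> and \<open>- (2 * d)\<close>, which contains the origin and all the points
    \<open>p\<close>, \<open>q\<close>.\<close>
  define R where "R = 2 ^ CARD('n) * (4 * d)"
  have R: "R > 0" using d by (simp add: R_def)
  \<comment> \<open>Each of the three short steps costs \<open>H * \<omega> R\<close>, hence at most
    \<open>e / 6 * \<omega> r\<close>; the two long ones cost \<open>e / 4 * \<omega> r\<close>
    each.\<close>
  obtain L where L: "L > 0" "\<And>t. t \<ge> L \<Longrightarrow> 6 * H * \<omega> R / e \<le> \<omega> t"
    using \<omega>_eventually_ge[OF lim] by metis
  \<comment> \<open>The bound \<open>2 * d\<close> keeps \<open>norm x / 2\<close> above
    \<open>d\<close> for nearby pairs; the other term forces \<open>r > L\<close> for pairs with
    \<open>norm x < 2 ^ (n + 1) * r\<close>.\<close>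
  define d' where "d' = max (2 * d) (2 ^ (CARD('n) + 1) * L)"
  have "norm (g x - g y) \<le> e * \<omega> (norm (x - y))" if xy: "x \<noteq> y" "d' < norm x" "d' < norm y" for x y
  proof -
    define r where "r = norm (x - y)"
    have r: "r > 0" using xy(1) by (simp add: r_def)
    have \<omega>r: "\<omega> r > 0" by (rule \<omega>_pos[OF r])
    show ?thesis
    proof (cases "2 ^ CARD('n) * r \<le> norm x / 2")
      case True
      obtain a where a: "x \<in> cube a r" "y \<in> cube a r"
        unfolding r_def by (rule common_cube)
      have away: "d < norm z" if "z \<in> cube a r" for z
      proof -
        have "norm (x - z) \<le> norm x / 2"
          using norm_cube_diff_le[OF a(1) that] True by linarith
        then have "norm x / 2 \<le> norm z"
          using norm_triangle_ineq2[of x z] by linarith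
        then show ?thesis using xy(2) by (simp add: d'_def)
      qed
      have "norm (g x - g y) \<le> 2 ^ (CARD('n) + 1) * m * (1 + 2 * D) * \<omega> r"
      proof (rule norm_diff_le_telescope[OF gc r _ a])
        fix b k assume "cube b (r / 2 ^ k) \<subseteq> cube a r"
        then show "mean_osc \<omega> g b (r / 2 ^ k) \<le> ennreal m"
          using away r by (intro d(2)) auto
      qed (use m in simp)
      also have "\<dots> \<le> e * \<omega> r"
        unfolding m(2) using C e \<omega>r by (intro mult_right_mono) (auto simp: divide_le_eq)
      finally show ?thesis by (simp add: r_def)
    next
      case False
      \<comment> \<open>Large enough for both points: \<open>norm x \<le> l / 2\<close> and
        \<open>norm y \<le> norm x + r \<le> l\<close>. Being \<open>r\<close> times a power of 2,
        it suits repeated doubling.\<close>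
      define l where "l = 2 ^ (CARD('n) + 2) * r"
      have l: "l > 0" using r by (simp add: l_def)
      have xl: "norm x \<le> l / 2" using False by (simp add: l_def algebra_simps)
      have "norm y \<le> norm x + r"
        unfolding r_def using norm_triangle_sub[of y x] by (simp add: norm_minus_commute)
      also have "\<dots> \<le> l"
      proof -
        have "(1::real) \<le> 2 ^ (CARD('n) + 1)" by (rule one_le_power) simp
        then have "r \<le> 2 ^ (CARD('n) + 1) * r" using r by simp
        also have "\<dots> = l / 2" by (simp add: l_def)
        finally show ?thesis using xl by linarith
      qed
      finally have yl: "norm y \<le> l" .
      have "2 ^ (CARD('n) + 1) * L \<le> d'" "l / 2 = 2 ^ (CARD('n) + 1) * r"
        by (simp_all add: d'_def l_def)
      then have "2 ^ (CARD('n) + 1) * L < 2 ^ (CARD('n) + 1) * r"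
        using xy(2) xl by linarith
      then have "L \<le> r" by simp
      then have HR: "H * \<omega> R \<le> e / 6 * \<omega> r"
        using L(2)[of r] e by (simp add: field_simps)
      have \<omega>l: "e / (4 * C) * \<omega> l \<le> e / 4 * \<omega> r"
      proof -
        have "\<omega> l \<le> C * \<omega> r"
          unfolding l_def C_def by (rule \<omega>_double_power[OF r])
        then have "e / (4 * C) * \<omega> l \<le> e / (4 * C) * (C * \<omega> r)"
          using e C by (intro mult_left_mono) auto
        also have "\<dots> = e / 4 * \<omega> r" using C by simp
        finally show ?thesis .
      qed
      have corner: "\<exists>p. p \<in> cube (\<chi> i. - (2 * d)) (4 * d) \<and> norm (g w - g p) \<le> H * \<omega> R + e / 4 * \<omega> r"
        if w: "norm w \<le> l" for w
      proof -
        obtain p where p: "p \<in> cube (\<chi> i. - (2 * d)) (4 * d)"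
          "norm (g (w + p) - g p) \<le> 2 ^ (CARD('n) + 1) * m * (1 + 2 * D) * \<omega> l"
          using norm_diff_corner_le[OF gc d(1) less_imp_le[OF m(1)] l w d(2)] by blast
        have "0 \<in> cube (\<chi> i. - (2 * d)) (4 * d)"
          unfolding mem_cube_iff using d(1) by simp
        then have "norm (0 - p) \<le> R"
          unfolding R_def using p(1) by (rule norm_cube_diff_le)
        then have "norm (g w - g (w + p)) \<le> H * \<omega> R"
          by (intro H(2)[OF R]) simp
        moreover have "norm (g (w + p) - g p) \<le> e / 4 * \<omega> r"
          using p(2) \<omega>l unfolding m(2) by linarith
        ultimately have "norm (g w - g p) \<le> H * \<omega> R + e / 4 * \<omega> r"
          by (rule norm_diff_triangle_le)
        with p(1) show ?thesis by blast
      qed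
      obtain p where p: "p \<in> cube (\<chi> i. - (2 * d)) (4 * d)" "norm (g x - g p) \<le> H * \<omega> R + e / 4 * \<omega> r"
        using corner[of x] xl l by auto
      obtain q where q: "q \<in> cube (\<chi> i. - (2 * d)) (4 * d)" "norm (g y - g q) \<le> H * \<omega> R + e / 4 * \<omega> r"
        using corner[OF yl] by blast
      have pq: "norm (g p - g q) \<le> H * \<omega> R"
        unfolding R_def by (intro H(2) R[unfolded R_def] norm_cube_diff_le[OF p(1) q(1)])
      have "norm (g x - g y) \<le> (H * \<omega> R + e / 4 * \<omega> r) + (H * \<omega> R + (H * \<omega> R + e / 4 * \<omega> r))"
        by (rule norm_diff_triangle_le[OF p(2) norm_diff_triangle_le[OF pq]])
          (use q(2) in \<open>simp only: norm_minus_commute\<close>)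
      also have "\<dots> \<le> e * \<omega> r"
        using HR by (simp add: field_simps)
      finally show ?thesis by (simp add: r_def)
    qed
  qed
  moreover have "d' > 0" using d(1) by (simp add: d'_def)
  ultimately show "\<exists>d>0. \<forall>x y. x \<noteq> y \<and> d < norm x \<and> d < norm y \<longrightarrow>
      norm (g x - g y) \<le> e * \<omega> (norm (x - y))"
    by blast
qed

subsection \<open>Representatives\<close>

lemma BMO_cong_AE:
  fixes f g :: "real^'n \<Rightarrow> 'b::banach"
  assumes "continuous_on UNIV g" "ae_rep f g"
  shows "f \<in> L1_loc" "mean_osc \<omega> f = mean_osc \<omega> g" "bmo_norm \<omega> f = bmo_norm \<omega> g"
    "f \<in> BMO \<omega> \<longleftrightarrow> g \<in> BMO \<omega>"
proof -
  show f: "f \<in> L1_loc" by (rule L1_loc_cong_AE[OF assms])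
  have g: "g \<in> L1_loc" by (rule continuous_imp_L1_loc[OF assms(1)])
  show osc: "mean_osc \<omega> f = mean_osc \<omega> g"
    by (intro ext mean_osc_cong_AE f g assms(2))
  show bmo: "bmo_norm \<omega> f = bmo_norm \<omega> g"
    by (simp add: bmo_norm_def osc)
  show "f \<in> BMO \<omega> \<longleftrightarrow> g \<in> BMO \<omega>"
    using f g by (simp add: BMO_def bmo)
qed

lemma BMO_has_holder_rep:
  fixes f :: "real^'n \<Rightarrow> 'b::banach"
  assumes "f \<in> BMO \<omega>"
  obtains g where "g \<in> holder_space \<omega>" "ae_rep f g"
proof -
  obtain g where g: "continuous_on UNIV g" "ae_rep f g"
    using BMO_has_continuous_rep[OF assms] by blast
  moreover from this have "g \<in> holder_space \<omega>"
    using assms BMO_imp_holder(1) by (simp add: BMO_cong_AE(4))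
  ultimately show ?thesis using that by blast
qed

text \<open>Every function in \<open>BMO\<close> has a Hoelder representative, so equality of the
  classes reduces to an equivalence for each pair of a function and its representative.\<close>

lemma ae_class_eqI:
  fixes V M :: "(real^'n \<Rightarrow> 'b::banach) set"
  assumes "V \<subseteq> holder_space \<omega>" "M \<subseteq> BMO \<omega>"
    and "\<And>f g. g \<in> holder_space \<omega> \<Longrightarrow> ae_rep f g \<Longrightarrow> g \<in> V \<longleftrightarrow> f \<in> M"
  shows "ae_class V = M"
proof
  show "ae_class V \<subseteq> M"
    using assms by (auto simp: ae_class_def)
  show "M \<subseteq> ae_class V"
  proof
    fix f assume "f \<in> M"
    with assms(2) obtain g where "g \<in> holder_space \<omega>" "ae_rep f g"
      using BMO_has_holder_rep by blast
    with assms(3) \<open>f \<in> M\<close> show "f \<in> ae_class V"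
      by (auto simp: ae_class_def)
  qed
qed

lemma VC_iff_VMO:
  fixes f g :: "real^'n \<Rightarrow> 'b::banach"
  assumes g: "g \<in> holder_space \<omega>" and fg: "ae_rep f g" and lim: "filterlim \<omega> at_top at_top"
  shows "g \<in> VC_small \<omega> \<longleftrightarrow> f \<in> VMO_small \<omega>"
    and "g \<in> VC_far \<omega> \<longleftrightarrow> f \<in> VMO_far \<omega>"
    and "g \<in> VC_large \<omega> \<longleftrightarrow> f \<in> VMO_large \<omega>"
proof -
  note AE = BMO_cong_AE(2,4)[OF continuous_holder[OF g] fg]
  have "g \<in> VMO_small \<omega> \<longleftrightarrow> f \<in> VMO_small \<omega>" "g \<in> VMO_far \<omega> \<longleftrightarrow> f \<in> VMO_far \<omega>"
      "g \<in> VMO_large \<omega> \<longleftrightarrow> f \<in> VMO_large \<omega>"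
    by (simp_all add: VMO_small_def VMO_far_def VMO_large_def AE)
  then show "g \<in> VC_small \<omega> \<longleftrightarrow> f \<in> VMO_small \<omega>" "g \<in> VC_far \<omega> \<longleftrightarrow> f \<in> VMO_far \<omega>"
      "g \<in> VC_large \<omega> \<longleftrightarrow> f \<in> VMO_large \<omega>"
    using VC_small_imp_VMO_small VMO_small_imp_VC_small[OF _ g]
      VC_far_imp_VMO_far VMO_far_imp_VC_far[OF _ g lim]
      VC_large_imp_VMO_large[OF _ lim] VMO_large_imp_VC_large[OF _ g lim] by blast+
qed

lemma ae_class_VC_eq_VMO:
  assumes lim: "filterlim \<omega> at_top at_top"
  shows "ae_class (VC_small \<omega>) = (VMO_small \<omega> :: (real^'n \<Rightarrow> 'b::banach) set)"
    and "ae_class (VC_far \<omega>) = (VMO_far \<omega> :: (real^'n \<Rightarrow> 'b) set)"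
    and "ae_class (VC_large \<omega>) = (VMO_large \<omega> :: (real^'n \<Rightarrow> 'b) set)"
    and "ae_class (VC \<omega>) = (VMO \<omega> :: (real^'n \<Rightarrow> 'b) set)"
proof -
  show "ae_class (VC_small \<omega>) = (VMO_small \<omega> :: (real^'n \<Rightarrow> 'b) set)"
    using VC_iff_VMO(1)[OF _ _ lim] by (intro ae_class_eqI) (auto simp: VC_small_def VMO_small_def)
  show "ae_class (VC_far \<omega>) = (VMO_far \<omega> :: (real^'n \<Rightarrow> 'b) set)"
    using VC_iff_VMO(2)[OF _ _ lim] by (intro ae_class_eqI) (auto simp: VC_far_def VMO_far_def)
  show "ae_class (VC_large \<omega>) = (VMO_large \<omega> :: (real^'n \<Rightarrow> 'b) set)"
    using VC_iff_VMO(3)[OF _ _ lim] by (intro ae_class_eqI) (auto simp: VC_large_def VMO_large_def)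
  show "ae_class (VC \<omega>) = (VMO \<omega> :: (real^'n \<Rightarrow> 'b) set)"
  proof (rule ae_class_eqI)
    show "(VC \<omega> :: (real^'n \<Rightarrow> 'b) set) \<subseteq> holder_space \<omega>"
      by (auto simp: VC_def VC_small_def)
    show "(VMO \<omega> :: (real^'n \<Rightarrow> 'b) set) \<subseteq> BMO \<omega>"
      by (auto simp: VMO_def VMO_small_def)
  qed (simp add: VC_def VMO_def VC_iff_VMO[OF _ _ lim])
qed

end

theorem theorem1p9:
  fixes \<omega> :: "real \<Rightarrow> real" and Cdb :: real
  assumes "\<And>t. t > 0 \<Longrightarrow> \<omega> t > 0"
    and "mono_on {0<..} \<omega>"
    and "Cdb > 1"
    and "\<And>t. t > 0 \<Longrightarrow> \<omega> (2 * t) \<le> Cdb * \<omega> t"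
    and "dini_const \<omega> < \<infinity>"
  shows
    "(\<forall>f :: real^'n \<Rightarrow> 'b::banach. f \<in> BMO \<omega> \<longrightarrow>
        (\<exists>g \<in> holder_space \<omega>. ae_rep f g) \<and>
        (\<forall>g \<in> holder_space \<omega>. ae_rep f g \<longrightarrow>
           holder_norm \<omega> g \<le>
             ennreal (const_holder_le_bmo CARD('n)) * dini_const \<omega> * bmo_norm \<omega> f)) \<and>
     (\<forall>f g :: real^'n \<Rightarrow> 'b. g \<in> holder_space \<omega> \<longrightarrow> ae_rep f g \<longrightarrow>
        f \<in> L1_loc \<and>
        bmo_norm \<omega> f \<le> ennreal (const_bmo_le_holder CARD('n) Cdb) * holder_norm \<omega> g) \<and>
     (filterlim \<omega> at_top at_top \<longrightarrow>
        ae_class (VC_small \<omega>) = (VMO_small \<omega> :: (real^'n \<Rightarrow> 'b) set) \<and>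
        ae_class (VC_far \<omega>) = (VMO_far \<omega> :: (real^'n \<Rightarrow> 'b) set) \<and>
        ae_class (VC_large \<omega>) = (VMO_large \<omega> :: (real^'n \<Rightarrow> 'b) set) \<and>
        ae_class (VC \<omega>) = (VMO \<omega> :: (real^'n \<Rightarrow> 'b) set))"
proof -
  obtain D where D: "D \<ge> 0" "dini_const \<omega> = ennreal D"
    using assms(5) by (cases "dini_const \<omega>") auto
  interpret dini_modulus \<omega> Cdb D
    using assms D by unfold_locales auto
  show ?thesis
  proof (intro conjI allI impI ballI)
    fix f :: "real^'n \<Rightarrow> 'b" assume f: "f \<in> BMO \<omega>"
    then show "\<exists>g\<in>holder_space \<omega>. ae_rep f g"
      using BMO_has_holder_rep by blast
    fix g assume g: "g \<in> holder_space \<omega>" "ae_rep f g"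
    note AE = BMO_cong_AE[OF continuous_holder[OF g(1)] g(2)]
    show "holder_norm \<omega> g \<le> ennreal (const_holder_le_bmo CARD('n)) * dini_const \<omega> * bmo_norm \<omega> f"
      unfolding AE(3) using f by (intro BMO_imp_holder(2) continuous_holder g(1)) (simp add: AE(4))
  next
    fix f g :: "real^'n \<Rightarrow> 'b" assume g: "g \<in> holder_space \<omega>" "ae_rep f g"
    note AE = BMO_cong_AE[OF continuous_holder[OF g(1)] g(2)]
    show "f \<in> L1_loc" by (rule AE(1))
    show "bmo_norm \<omega> f \<le> ennreal (const_bmo_le_holder CARD('n) Cdb) * holder_norm \<omega> g"
      unfolding AE(3) by (rule bmo_norm_le_holder_norm[OF g(1)])
  qed (rule ae_class_VC_eq_VMO; assumption)+
qed

end
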